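(* Let $\iota: R\to A$ be a centrally projective Frobenius extension. For every left $R$-module $T$, with $S=\operatorname{End}_R(T)$ and $B=\operatorname{End}_A(A\otimes_R T)$, the natural homomorphism of endomorphism rings $\rho: S\to B$, $\rho(s)=1_A\otimes s$, is a Frobenius extension. Moreover, there is an isomorphism of $R$-$B$-bimodules $T\otimes_S B\cong A\otimes_R T$.
   Context: All rings are associative with unit; modules are left modules unless otherwise specified. A ring extension $\iota:R\to A$ is a unital ring homomorphism. It is a Frobenius extension if $A$ is finitely generated projective as a left $R$-module and $A\cong\operatorname{Hom}_R(A,R)$ as $A$-$R$-bimodules, where $(af)(x)=f(xa)$ and $(fr)(x)=f(x)r$. A Frobenius extension is centrally projective if ${}_RA_R$ is isomorphic, as an $R$-$R$-bimodule, to a direct summand of $R^n$ for some $n\geq 1$. Endomorphism rings use the right-action convention: for $s_1,s_2\in S$, $t(s_1s_2)=(ts_1)s_2$, i.e. $s_1s_2=s_2\circ s_1$. Thus $T$ is an $R$-$S$-bimodule via $ts=s(t)$, and similarly $A\otimes_R T$ is an $A$-$B$-bimodule. Explicitly, $(a\otimes t)\rho(s)=a\otimes ts$. $B$ is an $S$-$S$-bimodule via $\rho$. *)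

theory Defs
  imports "HOL-Algebra.Module" "HOL-Algebra.RingHom" "HOL-Algebra.Free_Abelian_Groups"
begin

section \<open>Modules and bimodules over noncommutative rings\<close>

text \<open>
  As everywhere in HOL-Algebra, only the values of the operations on carriers matter. As in the
  library's record \<open>module\<close>, the fields \<open>mult\<close> and \<open>one\<close> are present in every (bi)module below
  but carry no meaning. The library's locale \<open>module\<close> cannot be used because it assumes a
  commutative ring of scalars.
\<close>

locale left_module = R?: ring R + M?: abelian_group M
  for R :: "('r, 'x) ring_scheme" (structure) and M :: "('r, 'm, 'y) module_scheme" (structure) +
  assumes smult_closed:
      "\<lbrakk>a \<in> carrier R; x \<in> carrier M\<rbrakk> \<Longrightarrow> a \<odot>\<^bsub>M\<^esub> x \<in> carrier M"
    and smult_l_distr: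
      "\<lbrakk>a \<in> carrier R; b \<in> carrier R; x \<in> carrier M\<rbrakk> \<Longrightarrow>
        (a \<oplus> b) \<odot>\<^bsub>M\<^esub> x = a \<odot>\<^bsub>M\<^esub> x \<oplus>\<^bsub>M\<^esub> b \<odot>\<^bsub>M\<^esub> x"
    and smult_r_distr:
      "\<lbrakk>a \<in> carrier R; x \<in> carrier M; y \<in> carrier M\<rbrakk> \<Longrightarrow>
        a \<odot>\<^bsub>M\<^esub> (x \<oplus>\<^bsub>M\<^esub> y) = a \<odot>\<^bsub>M\<^esub> x \<oplus>\<^bsub>M\<^esub> a \<odot>\<^bsub>M\<^esub> y"
    and smult_assoc1:
      "\<lbrakk>a \<in> carrier R; b \<in> carrier R; x \<in> carrier M\<rbrakk> \<Longrightarrow>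
        (a \<otimes> b) \<odot>\<^bsub>M\<^esub> x = a \<odot>\<^bsub>M\<^esub> (b \<odot>\<^bsub>M\<^esub> x)"
    and smult_one: "x \<in> carrier M \<Longrightarrow> \<one> \<odot>\<^bsub>M\<^esub> x = x"

record ('r, 'm, 's) bimodule = "('r, 'm) module" +
  rsmult :: "['m, 's] \<Rightarrow> 'm" (infixl \<open>\<cdot>\<index>\<close> 70)

text \<open>Homomorphisms are extensional functions, so that \<open>left_hom R M N\<close> is in bijection with
  the set of \<open>R\<close>-linear maps from \<open>M\<close> to \<open>N\<close>.\<close>

definition left_hom ::
    "('r, 'x) ring_scheme \<Rightarrow> ('r, 'm, 'y) module_scheme \<Rightarrow> ('r, 'n, 'z) module_scheme \<Rightarrow> ('m \<Rightarrow> 'n) set"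
  where "left_hom R M N =
    {f \<in> carrier M \<rightarrow>\<^sub>E carrier N.
       (\<forall>x\<in>carrier M. \<forall>y\<in>carrier M. f (x \<oplus>\<^bsub>M\<^esub> y) = f x \<oplus>\<^bsub>N\<^esub> f y) \<and>
       (\<forall>r\<in>carrier R. \<forall>x\<in>carrier M. f (r \<odot>\<^bsub>M\<^esub> x) = r \<odot>\<^bsub>N\<^esub> f x)}"

definition left_iso ::
    "('r, 'x) ring_scheme \<Rightarrow> ('r, 'm, 'y) module_scheme \<Rightarrow> ('r, 'n, 'z) module_scheme \<Rightarrow> bool"
  where "left_iso R M N \<longleftrightarrow> (\<exists>f\<in>left_hom R M N. bij_betw f (carrier M) (carrier N))"

definition bimodule_iso ::
    "('r, 'x) ring_scheme \<Rightarrow> ('s, 'w) ring_scheme \<Rightarrow>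
     ('r, 'm, 's, 'y) bimodule_scheme \<Rightarrow> ('r, 'n, 's, 'z) bimodule_scheme \<Rightarrow> bool"
  where "bimodule_iso R S M N \<longleftrightarrow>
    (\<exists>f\<in>left_hom R M N. bij_betw f (carrier M) (carrier N) \<and>
       (\<forall>x\<in>carrier M. \<forall>s\<in>carrier S. f (x \<cdot>\<^bsub>M\<^esub> s) = f x \<cdot>\<^bsub>N\<^esub> s))"

definition module_summand ::
    "'m set \<Rightarrow> ('r, 'x) ring_scheme \<Rightarrow> ('r, 'm, 'y) module_scheme \<Rightarrow> bool"
  where "module_summand H R M \<longleftrightarrow>
    submodule H R M \<and>
    (\<exists>K. submodule K R M \<and> H \<inter> K = {\<zero>\<^bsub>M\<^esub>} \<and> H <+>\<^bsub>M\<^esub> K = carrier M)"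

definition subbimodule ::
    "'m set \<Rightarrow> ('r, 'x) ring_scheme \<Rightarrow> ('s, 'w) ring_scheme \<Rightarrow> ('r, 'm, 's, 'y) bimodule_scheme \<Rightarrow> bool"
  where "subbimodule H R S M \<longleftrightarrow>
    submodule H R M \<and> (\<forall>x\<in>H. \<forall>s\<in>carrier S. x \<cdot>\<^bsub>M\<^esub> s \<in> H)"

definition bimodule_summand ::
    "'m set \<Rightarrow> ('r, 'x) ring_scheme \<Rightarrow> ('s, 'w) ring_scheme \<Rightarrow> ('r, 'm, 's, 'y) bimodule_scheme \<Rightarrow> bool"
  where "bimodule_summand H R S M \<longleftrightarrow>
    subbimodule H R S M \<and>
    (\<exists>K. subbimodule K R S M \<and> H \<inter> K = {\<zero>\<^bsub>M\<^esub>} \<and> H <+>\<^bsub>M\<^esub> K = carrier M)"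

text \<open>The direct sum of copies of \<open>R\<close> indexed by \<open>I\<close>, as an \<open>R\<close>-\<open>R\<close>-bimodule;
  \<open>R\<^sup>n\<close> is \<open>free_bimodule R {..<n}\<close>.\<close>

definition free_bimodule :: "('r, 'x) ring_scheme \<Rightarrow> 'i set \<Rightarrow> ('r, 'i \<Rightarrow> 'r, 'r) bimodule"
  where "free_bimodule R I =
    \<lparr>carrier = {v \<in> I \<rightarrow>\<^sub>E carrier R. finite {i \<in> I. v i \<noteq> \<zero>\<^bsub>R\<^esub>}},
     monoid.mult = undefined, monoid.one = undefined,
     ring.zero = (\<lambda>i\<in>I. \<zero>\<^bsub>R\<^esub>),
     ring.add = (\<lambda>v w. \<lambda>i\<in>I. v i \<oplus>\<^bsub>R\<^esub> w i),
     smult = (\<lambda>r v. \<lambda>i\<in>I. r \<otimes>\<^bsub>R\<^esub> v i),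
     rsmult = (\<lambda>v r. \<lambda>i\<in>I. v i \<otimes>\<^bsub>R\<^esub> r)\<rparr>"

definition finitely_generated :: "('r, 'x) ring_scheme \<Rightarrow> ('r, 'm, 'y) module_scheme \<Rightarrow> bool"
  where "finitely_generated R M \<longleftrightarrow>
    (\<exists>G. finite G \<and> G \<subseteq> carrier M \<and> (\<forall>H. submodule H R M \<and> G \<subseteq> H \<longrightarrow> H = carrier M))"

text \<open>A module is projective if it is a direct summand of a free module. Taking the basis \<open>I\<close>
  from the type of elements of \<open>M\<close> is no restriction: if \<open>M\<close> is projective, the canonical
  surjection from the free module on \<open>carrier M\<close> onto \<open>M\<close> splits.\<close>

definition projective :: "('r, 'x) ring_scheme \<Rightarrow> ('r, 'm, 'y) module_scheme \<Rightarrow> bool"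
  where "projective R M \<longleftrightarrow>
    (\<exists>(I :: 'm set) H. module_summand H R (free_bimodule R I) \<and>
       left_iso R M ((free_bimodule R I)\<lparr>carrier := H\<rparr>))"


section \<open>Hom modules and endomorphism rings\<close>

text \<open>For an \<open>R\<close>-\<open>A\<close>-bimodule \<open>M\<close> and an \<open>R\<close>-\<open>S\<close>-bimodule \<open>N\<close>, the \<open>R\<close>-linear maps from \<open>M\<close>
  to \<open>N\<close> form an \<open>A\<close>-\<open>S\<close>-bimodule.\<close>

definition hom_bimodule ::
    "('r, 'x) ring_scheme \<Rightarrow> ('r, 'm, 'a, 'y) bimodule_scheme \<Rightarrow> ('r, 'n, 's, 'z) bimodule_scheme \<Rightarrow>
     ('a, 'm \<Rightarrow> 'n, 's) bimodule"
  where "hom_bimodule R M N =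
    \<lparr>carrier = left_hom R M N,
     monoid.mult = undefined, monoid.one = undefined,
     ring.zero = (\<lambda>x\<in>carrier M. \<zero>\<^bsub>N\<^esub>),
     ring.add = (\<lambda>f g. \<lambda>x\<in>carrier M. f x \<oplus>\<^bsub>N\<^esub> g x),
     smult = (\<lambda>a f. \<lambda>x\<in>carrier M. f (x \<cdot>\<^bsub>M\<^esub> a)),
     rsmult = (\<lambda>f s. \<lambda>x\<in>carrier M. f x \<cdot>\<^bsub>N\<^esub> s)\<rparr>"

text \<open>Endomorphisms act from the right, so the product \<open>f g\<close> is \<open>g \<circ> f\<close>.\<close>

definition end_ring :: "('r, 'x) ring_scheme \<Rightarrow> ('r, 'm, 'y) module_scheme \<Rightarrow> ('m \<Rightarrow> 'm) ring"
  where "end_ring R M =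
    \<lparr>carrier = left_hom R M M,
     monoid.mult = (\<lambda>f g. compose (carrier M) g f),
     monoid.one = (\<lambda>x\<in>carrier M. x),
     ring.zero = (\<lambda>x\<in>carrier M. \<zero>\<^bsub>M\<^esub>),
     ring.add = (\<lambda>f g. \<lambda>x\<in>carrier M. f x \<oplus>\<^bsub>M\<^esub> g x)\<rparr>"

definition end_bimodule :: "('r, 'm, 'y) module_scheme \<Rightarrow> ('r, 'm, 'm \<Rightarrow> 'm) bimodule"
  where "end_bimodule M =
    \<lparr>carrier = carrier M,
     monoid.mult = monoid.mult M, monoid.one = monoid.one M,
     ring.zero = ring.zero M, ring.add = ring.add M,
     smult = smult M, rsmult = (\<lambda>x f. f x)\<rparr>"


section \<open>Change of scalars\<close>

text \<open>A ring \<open>A\<close> as a bimodule, with left and right scalars acting through the ring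
  homomorphisms \<open>f\<close> and \<open>g\<close> into \<open>A\<close>.\<close>

definition ring_bimodule ::
    "('a, 'x) ring_scheme \<Rightarrow> ('r \<Rightarrow> 'a) \<Rightarrow> ('s \<Rightarrow> 'a) \<Rightarrow> ('r, 'a, 's) bimodule"
  where "ring_bimodule A f g =
    \<lparr>carrier = carrier A,
     monoid.mult = monoid.mult A, monoid.one = monoid.one A,
     ring.zero = ring.zero A, ring.add = ring.add A,
     smult = (\<lambda>r x. f r \<otimes>\<^bsub>A\<^esub> x), rsmult = (\<lambda>x s. x \<otimes>\<^bsub>A\<^esub> g s)\<rparr>"

definition restrict_left_scalars ::
    "('r \<Rightarrow> 'a) \<Rightarrow> ('a, 'm, 's, 'y) bimodule_scheme \<Rightarrow> ('r, 'm, 's) bimodule"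
  where "restrict_left_scalars f M =
    \<lparr>carrier = carrier M,
     monoid.mult = monoid.mult M, monoid.one = monoid.one M,
     ring.zero = ring.zero M, ring.add = ring.add M,
     smult = (\<lambda>r x. f r \<odot>\<^bsub>M\<^esub> x), rsmult = rsmult M\<rparr>"


section \<open>Tensor products\<close>

text \<open>The tensor product over \<open>R\<close> of a right \<open>R\<close>-module \<open>M\<close> and a left \<open>R\<close>-module \<open>N\<close> is the
  quotient of the free abelian group on \<open>carrier M \<times> carrier N\<close> by the subgroup generated by the
  usual relations.\<close>

inductive_set tensor_relations ::
    "('r, 'x) ring_scheme \<Rightarrow> ('a, 'm, 'r, 'y) bimodule_scheme \<Rightarrow> ('r, 'n, 'z) module_scheme \<Rightarrow>
     ('m \<times> 'n \<Rightarrow>\<^sub>0 int) set"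
  for R and M and N
  where
    add_left: "\<lbrakk>m \<in> carrier M; m' \<in> carrier M; n \<in> carrier N\<rbrakk> \<Longrightarrow>
      frag_of (m \<oplus>\<^bsub>M\<^esub> m', n) - frag_of (m, n) - frag_of (m', n) \<in> tensor_relations R M N"
  | add_right: "\<lbrakk>m \<in> carrier M; n \<in> carrier N; n' \<in> carrier N\<rbrakk> \<Longrightarrow>
      frag_of (m, n \<oplus>\<^bsub>N\<^esub> n') - frag_of (m, n) - frag_of (m, n') \<in> tensor_relations R M N"
  | balanced: "\<lbrakk>m \<in> carrier M; r \<in> carrier R; n \<in> carrier N\<rbrakk> \<Longrightarrow>
      frag_of (m \<cdot>\<^bsub>M\<^esub> r, n) - frag_of (m, r \<odot>\<^bsub>N\<^esub> n) \<in> tensor_relations R M N"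

definition tensor_free ::
    "('a, 'm, 'r, 'y) bimodule_scheme \<Rightarrow> ('r, 'n, 'z) module_scheme \<Rightarrow> ('m \<times> 'n \<Rightarrow>\<^sub>0 int) monoid"
  where "tensor_free M N = free_Abelian_group (carrier M \<times> carrier N)"

definition tensor_kernel ::
    "('r, 'x) ring_scheme \<Rightarrow> ('a, 'm, 'r, 'y) bimodule_scheme \<Rightarrow> ('r, 'n, 'z) module_scheme \<Rightarrow>
     ('m \<times> 'n \<Rightarrow>\<^sub>0 int) set"
  where "tensor_kernel R M N = generate (tensor_free M N) (tensor_relations R M N)"

text \<open>The endomorphism \<open>f \<otimes> g\<close> of the tensor product. The linear extension of
  \<open>(m, n) \<mapsto> (f m, g n)\<close> maps a coset \<open>c\<close> of the kernel into a single coset whenever it maps the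
  kernel into itself; adding the kernel to the image of \<open>c\<close> gives all of that coset.\<close>

definition tensor_map ::
    "('r, 'x) ring_scheme \<Rightarrow> ('a, 'm, 'r, 'y) bimodule_scheme \<Rightarrow> ('r, 'n, 'z) module_scheme \<Rightarrow>
     ('m \<Rightarrow> 'm) \<Rightarrow> ('n \<Rightarrow> 'n) \<Rightarrow> ('m \<times> 'n \<Rightarrow>\<^sub>0 int) set \<Rightarrow> ('m \<times> 'n \<Rightarrow>\<^sub>0 int) set"
  where "tensor_map R M N f g c =
    tensor_kernel R M N <#>\<^bsub>tensor_free M N\<^esub>
      (frag_extend (\<lambda>(m, n). frag_of (f m, g n)) ` c)"

definition tensor ::
    "('r, 'x) ring_scheme \<Rightarrow> ('a, 'm, 'r, 'y) bimodule_scheme \<Rightarrow> ('r, 'n, 's, 'z) bimodule_scheme \<Rightarrow>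
     ('a, ('m \<times> 'n \<Rightarrow>\<^sub>0 int) set, 's) bimodule"
  where "tensor R M N =
    \<lparr>carrier = carrier (tensor_free M N Mod tensor_kernel R M N),
     monoid.mult = undefined, monoid.one = undefined,
     ring.zero = monoid.one (tensor_free M N Mod tensor_kernel R M N),
     ring.add = monoid.mult (tensor_free M N Mod tensor_kernel R M N),
     smult = (\<lambda>a. tensor_map R M N (\<lambda>m. a \<odot>\<^bsub>M\<^esub> m) (\<lambda>n. n)),
     rsmult = (\<lambda>c s. tensor_map R M N (\<lambda>m. m) (\<lambda>n. n \<cdot>\<^bsub>N\<^esub> s) c)\<rparr>"


section \<open>Frobenius extensions\<close>

definition frobenius_extension ::
    "('r, 'x) ring_scheme \<Rightarrow> ('a, 'y) ring_scheme \<Rightarrow> ('r \<Rightarrow> 'a) \<Rightarrow> bool"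
  where "frobenius_extension R A \<iota> \<longleftrightarrow>
    ring_hom_ring R A \<iota> \<and>
    finitely_generated R (ring_bimodule A \<iota> \<iota>) \<and>
    projective R (ring_bimodule A \<iota> \<iota>) \<and>
    bimodule_iso A R (ring_bimodule A id \<iota>)
      (hom_bimodule R (ring_bimodule A \<iota> id) (ring_bimodule R id id))"

definition centrally_projective ::
    "('r, 'x) ring_scheme \<Rightarrow> ('a, 'y) ring_scheme \<Rightarrow> ('r \<Rightarrow> 'a) \<Rightarrow> bool"
  where "centrally_projective R A \<iota> \<longleftrightarrow>
    (\<exists>n\<ge>1. \<exists>H. bimodule_summand H R R (free_bimodule R {..<n::nat}) \<and>
       bimodule_iso R R (ring_bimodule A \<iota> \<iota>) ((free_bimodule R {..<n})\<lparr>carrier := H\<rparr>))"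

text \<open>\<open>A \<otimes>\<^sub>R T\<close> as an \<open>A\<close>-module; its right scalars are the \<open>R\<close>-endomorphisms of \<open>T\<close>.\<close>

definition induced_module ::
    "('r, 'x) ring_scheme \<Rightarrow> ('a, 'y) ring_scheme \<Rightarrow> ('r \<Rightarrow> 'a) \<Rightarrow> ('r, 't, 'z) module_scheme \<Rightarrow>
     ('a, ('a \<times> 't \<Rightarrow>\<^sub>0 int) set, 't \<Rightarrow> 't) bimodule"
  where "induced_module R A \<iota> T = tensor R (ring_bimodule A id \<iota>) (end_bimodule T)"

text \<open>The map \<open>s \<mapsto> 1\<^sub>A \<otimes> s\<close>.\<close>

definition induced_end ::
    "('r, 'x) ring_scheme \<Rightarrow> ('a, 'y) ring_scheme \<Rightarrow> ('r \<Rightarrow> 'a) \<Rightarrow> ('r, 't, 'z) module_scheme \<Rightarrow>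
     ('t \<Rightarrow> 't) \<Rightarrow> ('a \<times> 't \<Rightarrow>\<^sub>0 int) set \<Rightarrow> ('a \<times> 't \<Rightarrow>\<^sub>0 int) set"
  where "induced_end R A \<iota> T s =
    restrict (tensor_map R (ring_bimodule A id \<iota>) (end_bimodule T) (\<lambda>a. a) s)
      (carrier (induced_module R A \<iota> T))"

end

theory Submission
  imports Defs
begin

text \<open>
  A ring extension \<open>\<iota>: R \<rightarrow> A\<close> is Frobenius if it has a Frobenius system: an \<open>R\<close>-bimodule map
  \<open>E: A \<rightarrow> R\<close> and elements \<open>c\<^sub>i, d\<^sub>i\<close> of \<open>A\<close> with
  \<open>\<Sum>\<^sub>i \<iota>(E(a d\<^sub>i)) c\<^sub>i = a = \<Sum>\<^sub>i d\<^sub>i \<iota>(E(c\<^sub>i a))\<close> for all \<open>a\<close>. If the Frobenius extension is also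
  centrally projective, the \<open>c\<^sub>i\<close> and \<open>d\<^sub>i\<close> can be chosen in the centralizer of \<open>R\<close>: take the \<open>c\<^sub>i\<close> to be
  the projections of the central unit vectors of \<open>R\<^sup>n\<close>, and the \<open>d\<^sub>i\<close> to represent the coordinate maps
  of \<open>A\<close>, which are bimodule maps. Right multiplications by \<open>c\<^sub>i\<close> and \<open>d\<^sub>i\<close> are then well defined on
  \<open>A \<otimes>\<^sub>R T\<close>, and together with \<open>\<beta> \<mapsto> (t \<mapsto> (E \<otimes> T)(\<beta>(1 \<otimes> t)))\<close> they form a Frobenius system of
  \<open>S \<rightarrow> B\<close>. The isomorphism \<open>T \<otimes>\<^sub>S B \<cong> A \<otimes>\<^sub>R T\<close> maps \<open>t \<otimes> \<beta>\<close> to \<open>\<beta>(1 \<otimes> t)\<close>; its inverse comes from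
  the same dual bases, \<open>u \<mapsto> \<Sum>\<^sub>i (E \<otimes> T)(u d\<^sub>i) \<otimes> c\<^sub>i\<close>.
\<close>

section \<open>Additive maps and finite sums\<close>

text \<open>A Frobenius system replaces statements about modules by two finite identities, and those
  can be checked inside B. An element of B is determined by its values on the tensors 1 \<otimes> t,
  which generate A \<otimes> T over A. With u = \<beta>(1 \<otimes> t), the two identities for
  \<beta> become two expansions of u, as the sum of c_i \<otimes> (E \<otimes> T)(u d_i) and as the
  sum of d_i \<otimes> (E \<otimes> T)(c_i u). In the first one the scalar \<iota>(E(a d_i)) stands
  to the left of c_i in the identity for A and has to pass c_i to reach the tensor sign: a second
  use of the centralizer. In the second one it already stands on the correct side. The right-action
  convention turns right multiplication by b b' into the product in B of those by b and b' in the
  same order, so neither identity changes sides. Commutation with R has two different sources: for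
  c_i it is read off from components in a direct sum, for d_i from the nondegeneracy of (x, a)
  \<mapsto> E(x a).\<close>

lemma abelian_group_hom_of_additive:
  assumes "abelian_group G" "abelian_group H"
    and "\<And>x. x \<in> carrier G \<Longrightarrow> h x \<in> carrier H"
    and "\<And>x y. \<lbrakk>x \<in> carrier G; y \<in> carrier G\<rbrakk> \<Longrightarrow> h (x \<oplus>\<^bsub>G\<^esub> y) = h x \<oplus>\<^bsub>H\<^esub> h y"
  shows "abelian_group_hom G H h"
  using assms
  by (intro abelian_group_homI group_hom.intro group_hom_axioms.intro homI)
    (auto intro: abelian_group.a_group)

text \<open>Over an infinite \<open>I\<close> both sums are zero by convention, so there the
  identity is preservation of zero.\<close>

lemma (in abelian_group_hom) hom_finsum:
  assumes "f \<in> I \<rightarrow> carrier G"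
  shows "h (\<Oplus>\<^bsub>G\<^esub>i\<in>I. f i) = (\<Oplus>\<^bsub>H\<^esub>i\<in>I. h (f i))"
  using assms by (induct I rule: infinite_finite_induct) (auto simp: Pi_iff)

lemma abelian_group_hom_compose:
  assumes "abelian_group_hom G H f" "abelian_group_hom H L g"
  shows "abelian_group_hom G L (\<lambda>x. g (f x))"
proof -
  interpret f: abelian_group_hom G H f by fact
  interpret g: abelian_group_hom H L g by fact
  show ?thesis
    by (rule abelian_group_hom_of_additive) (simp_all add: f.G.abelian_group_axioms g.H.abelian_group_axioms)
qed

lemma abelian_group_hom_finsum:
  assumes "abelian_group G" "abelian_group H" "\<And>i. i \<in> I \<Longrightarrow> abelian_group_hom G H (f i)"
  shows "abelian_group_hom G H (\<lambda>x. \<Oplus>\<^bsub>H\<^esub>i\<in>I. f i x)"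
proof -
  interpret G: abelian_group G by fact
  interpret H: abelian_group H by fact
  have f: "f i x \<in> carrier H" if "i \<in> I" "x \<in> carrier G" for i x
    using abelian_group_hom.hom_closed[OF assms(3)] that by blast
  show ?thesis
  proof (rule abelian_group_hom_of_additive[OF assms(1,2)])
    fix x y assume xy: "x \<in> carrier G" "y \<in> carrier G"
    then have "(\<Oplus>\<^bsub>H\<^esub>i\<in>I. f i (x \<oplus>\<^bsub>G\<^esub> y)) = (\<Oplus>\<^bsub>H\<^esub>i\<in>I. f i x \<oplus>\<^bsub>H\<^esub> f i y)"
      by (intro H.finsum_cong')
        (auto intro!: f simp: abelian_group_hom.hom_add[OF assms(3)])
    with xy f show "(\<Oplus>\<^bsub>H\<^esub>i\<in>I. f i (x \<oplus>\<^bsub>G\<^esub> y)) = (\<Oplus>\<^bsub>H\<^esub>i\<in>I. f i x) \<oplus>\<^bsub>H\<^esub> (\<Oplus>\<^bsub>H\<^esub>i\<in>I. f i y)"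
      by (simp add: H.finsum_addf Pi_iff)
  qed (use f in \<open>auto intro: H.finsum_closed\<close>)
qed

lemma abelian_group_hom_restrict:
  assumes "abelian_group_hom G H f"
  shows "abelian_group_hom G H (restrict f (carrier G))"
proof -
  interpret f: abelian_group_hom G H f by fact
  show ?thesis
    by (rule abelian_group_hom_of_additive) (simp_all add: f.G.abelian_group_axioms f.H.abelian_group_axioms)
qed

lemma finsum_in_subgroup:
  assumes "abelian_group M" "subgroup H (add_monoid M)" "f \<in> I \<rightarrow> H"
  shows "(\<Oplus>\<^bsub>M\<^esub>i\<in>I. f i) \<in> H"
proof -
  interpret M: abelian_group M by fact
  interpret H: subgroup H "add_monoid M" by fact
  have sub: "H \<subseteq> carrier M" using H.subset by simp
  have zero: "\<zero>\<^bsub>M\<^esub> \<in> H" using H.one_closed by simp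
  have add: "x \<oplus>\<^bsub>M\<^esub> y \<in> H" if "x \<in> H" "y \<in> H" for x y using H.m_closed that by simp
  show ?thesis
    using assms(3)
  proof (induct I rule: infinite_finite_induct)
    case (insert i I)
    then have "(\<Oplus>\<^bsub>M\<^esub>i\<in>insert i I. f i) = f i \<oplus>\<^bsub>M\<^esub> (\<Oplus>\<^bsub>M\<^esub>i\<in>I. f i)"
      using sub by (subst M.finsum_insert) auto
    with insert add show ?case by auto
  qed (simp_all add: zero)
qed

text \<open>Serves to collect the coordinates that belong to equal members of a dual basis.\<close>

lemma (in abelian_monoid) finsum_fibres:
  assumes "finite I" "f \<in> I \<rightarrow> carrier G"
  shows "(\<Oplus>i\<in>I. f i) = (\<Oplus>j\<in>c ` I. \<Oplus>i\<in>{i \<in> I. c i = j}. f i)"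
proof -
  have "I = (\<Union>j\<in>c ` I. {i \<in> I. c i = j})" by auto
  then have "(\<Oplus>i\<in>I. f i) = (\<Oplus>i\<in>(\<Union>j\<in>c ` I. {i \<in> I. c i = j}). f i)" by simp
  also have "\<dots> = (\<Oplus>j\<in>c ` I. \<Oplus>i\<in>{i \<in> I. c i = j}. f i)"
    using assms by (intro add.finprod_UN_disjoint) (auto simp: pairwise_def disjnt_def)
  finally show ?thesis .
qed


section \<open>Tensor products\<close>

text \<open>Instantiated twice, for A \<otimes> T over R and for T \<otimes> B over S. Closure under
  the two scalar actions keeps the balancing relations inside the free abelian group.\<close>

locale tensor_factors = M?: abelian_group M + N?: abelian_group N
  for R :: "('r, 'x) ring_scheme" and M :: "('a, 'm, 'r, 'y) bimodule_scheme"
    and N :: "('r, 'n, 's, 'z) bimodule_scheme" +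
  assumes rsmult_closed: "\<lbrakk>m \<in> carrier M; r \<in> carrier R\<rbrakk> \<Longrightarrow> m \<cdot>\<^bsub>M\<^esub> r \<in> carrier M"
    and smult_closed: "\<lbrakk>r \<in> carrier R; n \<in> carrier N\<rbrakk> \<Longrightarrow> r \<odot>\<^bsub>N\<^esub> n \<in> carrier N"

definition pure_tensor ::
    "('r, 'x) ring_scheme \<Rightarrow> ('a, 'm, 'r, 'y) bimodule_scheme \<Rightarrow> ('r, 'n, 'z) module_scheme \<Rightarrow>
      'm \<Rightarrow> 'n \<Rightarrow> ('m \<times> 'n \<Rightarrow>\<^sub>0 int) set"
  where "pure_tensor R M N m n = tensor_kernel R M N #>\<^bsub>tensor_free M N\<^esub> frag_of (m, n)"

context tensor_factors
begin

abbreviation "F \<equiv> tensor_free M N"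
abbreviation "K \<equiv> tensor_kernel R M N"
abbreviation "P \<equiv> tensor R M N"
abbreviation pure (infixl \<open>\<odot>\<odot>\<close> 75) where "m \<odot>\<odot> n \<equiv> pure_tensor R M N m n"

section \<open>The quotient of the free abelian group by the tensor relations\<close>

lemma comm_group_free: "comm_group F"
  by (simp add: tensor_free_def abelian_free_Abelian_group)

sublocale free: comm_group F
  by (rule comm_group_free)

lemma frag_of_closed: "\<lbrakk>m \<in> carrier M; n \<in> carrier N\<rbrakk> \<Longrightarrow> frag_of (m, n) \<in> carrier F"
  by (simp add: tensor_free_def)

lemma mult_free: "x \<otimes>\<^bsub>F\<^esub> y = x + y"
  by (simp add: tensor_free_def)

lemma one_free: "\<one>\<^bsub>F\<^esub> = 0"
  by (simp add: tensor_free_def)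

lemma uminus_closed: "x \<in> carrier F \<Longrightarrow> - x \<in> carrier F"
  by (simp add: tensor_free_def)

lemma diff_closed: "\<lbrakk>x \<in> carrier F; y \<in> carrier F\<rbrakk> \<Longrightarrow> x - y \<in> carrier F"
  using keys_diff[of x y] by (auto simp: tensor_free_def)

lemma relations_subset: "tensor_relations R M N \<subseteq> carrier F"
proof
  fix x assume "x \<in> tensor_relations R M N"
  then show "x \<in> carrier F"
    by cases (auto intro!: diff_closed frag_of_closed rsmult_closed smult_closed)
qed

lemma kernel_subgroup: "subgroup K F"
  unfolding tensor_kernel_def by (rule free.generate_is_subgroup[OF relations_subset])

lemma kernel_normal: "K \<lhd> F"
  using kernel_subgroup by (rule free.subgroup_imp_normal)

lemma comm_group_tensor: "comm_group (F Mod K)"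
  using kernel_subgroup by (rule free.abelian_FactGroup)

lemma tensor_simps:
  "carrier P = carrier (F Mod K)" "\<zero>\<^bsub>P\<^esub> = \<one>\<^bsub>F Mod K\<^esub>" "x \<oplus>\<^bsub>P\<^esub> y = x \<otimes>\<^bsub>F Mod K\<^esub> y"
  by (simp_all add: tensor_def)

lemma abelian_group_tensor: "abelian_group P"
proof -
  interpret Q: comm_group "F Mod K" by (rule comm_group_tensor)
  show ?thesis
  proof (rule abelian_groupI)
    show "\<exists>y\<in>carrier P. y \<oplus>\<^bsub>P\<^esub> x = \<zero>\<^bsub>P\<^esub>" if "x \<in> carrier P" for x
      using that Q.l_inv_ex unfolding tensor_simps by blast
    show "x \<oplus>\<^bsub>P\<^esub> y = y \<oplus>\<^bsub>P\<^esub> x" if "x \<in> carrier P" "y \<in> carrier P" for x y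
      using that Q.m_comm unfolding tensor_simps by blast
  qed (simp_all add: tensor_simps Q.m_assoc del: mult_FactGroup one_FactGroup)
qed

sublocale P: abelian_group P
  by (rule abelian_group_tensor)

lemma coset_closed: "x \<in> carrier F \<Longrightarrow> K #>\<^bsub>F\<^esub> x \<in> carrier P"
  by (auto simp: tensor_simps carrier_FactGroup)

lemma coset_add:
  "\<lbrakk>x \<in> carrier F; y \<in> carrier F\<rbrakk> \<Longrightarrow> K #>\<^bsub>F\<^esub> (x + y) = (K #>\<^bsub>F\<^esub> x) \<oplus>\<^bsub>P\<^esub> (K #>\<^bsub>F\<^esub> y)"
  using normal.rcos_sum[OF kernel_normal] by (simp add: tensor_simps mult_free)

lemma coset_eqI:
  assumes "x \<in> carrier F" "y \<in> carrier F" "x - y \<in> K"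
  shows "K #>\<^bsub>F\<^esub> x = K #>\<^bsub>F\<^esub> y"
  using free.coset_join2[OF _ kernel_subgroup assms(3)] assms
    coset_add[of "x - y" y] P.l_zero[OF coset_closed[OF assms(2)]]
  by (simp add: diff_closed tensor_simps)

lemma relation_in_kernel: "x \<in> tensor_relations R M N \<Longrightarrow> x \<in> K"
  unfolding tensor_kernel_def by (rule generate.incl)

lemma pure_closed: "\<lbrakk>m \<in> carrier M; n \<in> carrier N\<rbrakk> \<Longrightarrow> m \<odot>\<odot> n \<in> carrier P"
  unfolding pure_tensor_def by (intro coset_closed frag_of_closed)

lemma pure_add_left:
  assumes "m \<in> carrier M" "m' \<in> carrier M" "n \<in> carrier N"
  shows "(m \<oplus>\<^bsub>M\<^esub> m') \<odot>\<odot> n = m \<odot>\<odot> n \<oplus>\<^bsub>P\<^esub> m' \<odot>\<odot> n"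
proof -
  have "K #>\<^bsub>F\<^esub> frag_of (m \<oplus>\<^bsub>M\<^esub> m', n) = K #>\<^bsub>F\<^esub> (frag_of (m, n) + frag_of (m', n))"
    using relation_in_kernel[OF tensor_relations.add_left[OF assms]] assms
      free.m_closed[unfolded mult_free]
    by (intro coset_eqI) (auto intro!: frag_of_closed simp: algebra_simps)
  then show ?thesis
    using assms by (simp add: pure_tensor_def coset_add frag_of_closed)
qed

lemma pure_add_right:
  assumes "m \<in> carrier M" "n \<in> carrier N" "n' \<in> carrier N"
  shows "m \<odot>\<odot> (n \<oplus>\<^bsub>N\<^esub> n') = m \<odot>\<odot> n \<oplus>\<^bsub>P\<^esub> m \<odot>\<odot> n'"
proof -
  have "K #>\<^bsub>F\<^esub> frag_of (m, n \<oplus>\<^bsub>N\<^esub> n') = K #>\<^bsub>F\<^esub> (frag_of (m, n) + frag_of (m, n'))"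
    using relation_in_kernel[OF tensor_relations.add_right[OF assms]] assms
      free.m_closed[unfolded mult_free]
    by (intro coset_eqI) (auto intro!: frag_of_closed simp: algebra_simps)
  then show ?thesis
    using assms by (simp add: pure_tensor_def coset_add frag_of_closed)
qed

lemma pure_balanced:
  assumes "m \<in> carrier M" "r \<in> carrier R" "n \<in> carrier N"
  shows "(m \<cdot>\<^bsub>M\<^esub> r) \<odot>\<odot> n = m \<odot>\<odot> (r \<odot>\<^bsub>N\<^esub> n)"
  unfolding pure_tensor_def
  using relation_in_kernel[OF tensor_relations.balanced[OF assms]] assms
  by (intro coset_eqI) (auto intro!: frag_of_closed rsmult_closed smult_closed)

lemma pure_hom_left: "n \<in> carrier N \<Longrightarrow> abelian_group_hom M P (\<lambda>m. m \<odot>\<odot> n)"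
  by (rule abelian_group_hom_of_additive)
    (simp_all add: M.abelian_group_axioms P.abelian_group_axioms pure_closed pure_add_left)

text \<open>The additive extension of \<open>g\<close> to the free abelian group kills all three
  kinds of relations. Its kernel is a subgroup, hence contains the subgroup \<open>K\<close>
  generated by them, and the extension descends to the quotient.\<close>

lemma tensor_universal:
  assumes "abelian_group G"
    and closed: "\<And>m n. \<lbrakk>m \<in> carrier M; n \<in> carrier N\<rbrakk> \<Longrightarrow> g m n \<in> carrier G"
    and g_add_left: "\<And>m m' n. \<lbrakk>m \<in> carrier M; m' \<in> carrier M; n \<in> carrier N\<rbrakk> \<Longrightarrow>
      g (m \<oplus>\<^bsub>M\<^esub> m') n = g m n \<oplus>\<^bsub>G\<^esub> g m' n"
    and g_add_right: "\<And>m n n'. \<lbrakk>m \<in> carrier M; n \<in> carrier N; n' \<in> carrier N\<rbrakk> \<Longrightarrow>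
      g m (n \<oplus>\<^bsub>N\<^esub> n') = g m n \<oplus>\<^bsub>G\<^esub> g m n'"
    and g_balanced: "\<And>m r n. \<lbrakk>m \<in> carrier M; r \<in> carrier R; n \<in> carrier N\<rbrakk> \<Longrightarrow>
      g (m \<cdot>\<^bsub>M\<^esub> r) n = g m (r \<odot>\<^bsub>N\<^esub> n)"
  obtains h where "abelian_group_hom P G h"
    "\<And>m n. \<lbrakk>m \<in> carrier M; n \<in> carrier N\<rbrakk> \<Longrightarrow> h (m \<odot>\<odot> n) = g m n"
proof -
  interpret G: abelian_group G by fact
  have "case_prod g ` (carrier M \<times> carrier N) \<subseteq> carrier (add_monoid G)"
    using closed by auto
  from comm_group.free_Abelian_group_universal[OF G.a_comm_group this]
  obtain h where h: "h \<in> hom F (add_monoid G)"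
    and h_of: "\<And>p. p \<in> carrier M \<times> carrier N \<Longrightarrow> h (frag_of p) = case_prod g p"
    unfolding tensor_free_def by auto
  interpret h: group_hom F "add_monoid G" h
    by (intro group_hom.intro group_hom_axioms.intro h G.a_group free.is_group)
  have h_add: "h (x + y) = h x \<oplus>\<^bsub>G\<^esub> h y" if "x \<in> carrier F" "y \<in> carrier F" for x y
    using h.hom_mult[OF that] by (simp add: mult_free)
  have h_closed: "h x \<in> carrier G" if "x \<in> carrier F" for x
    using h.hom_closed[OF that] by simp
  have h_diff: "h (x - y) = h x \<ominus>\<^bsub>G\<^esub> h y" if "x \<in> carrier F" "y \<in> carrier F" for x y
    using h_add[of "x - y" y] that diff_closed[OF that] h_closed
    by (simp add: G.minus_eq G.add.m_assoc G.r_neg)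
  \<comment> \<open>The additivity relations are two successive differences; after
    \<open>h_diff\<close> and additivity of \<open>g\<close> their images have this form.\<close>
  have cancel: "a \<oplus>\<^bsub>G\<^esub> b \<ominus>\<^bsub>G\<^esub> a \<ominus>\<^bsub>G\<^esub> b = \<zero>\<^bsub>G\<^esub>" if "a \<in> carrier G" "b \<in> carrier G" for a b
  proof -
    have "a \<oplus>\<^bsub>G\<^esub> b \<ominus>\<^bsub>G\<^esub> a = b"
      using that by (simp add: G.minus_eq G.a_comm[of a b] G.a_assoc G.r_neg)
    with that show ?thesis by (simp add: G.minus_eq G.r_neg)
  qed
  have "tensor_relations R M N \<subseteq> kernel F (add_monoid G) h"
  proof
    fix x assume x: "x \<in> tensor_relations R M N"
    moreover from this have "h x = \<zero>\<^bsub>G\<^esub>"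
    proof cases
      case (add_left m m' n)
      then show ?thesis
        by (simp add: h_diff h_of frag_of_closed diff_closed g_add_left closed cancel)
    next
      case (add_right m n n')
      then show ?thesis
        by (simp add: h_diff h_of frag_of_closed diff_closed g_add_right closed cancel)
    next
      case (balanced m r n)
      then show ?thesis
        by (simp add: h_diff h_of frag_of_closed rsmult_closed smult_closed g_balanced closed
            G.minus_eq G.r_neg)
    qed
    ultimately show "x \<in> kernel F (add_monoid G) h"
      using relations_subset by (auto simp: kernel_def)
  qed
  then have "K \<subseteq> kernel F (add_monoid G) h"
    unfolding tensor_kernel_def by (rule free.generate_subgroup_incl[OF _ h.subgroup_kernel])
  then have kernel: "h x = \<zero>\<^bsub>G\<^esub>" if "x \<in> K" for x
    using that by (auto simp: kernel_def)
  have "h x = h y" if xy: "x \<in> carrier F" "y \<in> carrier F" "K #>\<^bsub>F\<^esub> x = K #>\<^bsub>F\<^esub> y" for x y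
  proof -
    have "x \<in> K #>\<^bsub>F\<^esub> y"
      using free.rcos_self[OF xy(1) kernel_subgroup] xy(3) by simp
    then obtain k where "k \<in> K" "x = k + y"
      by (auto simp: r_coset_def mult_free)
    moreover from this have "k \<in> carrier F"
      using subgroup.subset[OF kernel_subgroup] by auto
    ultimately show ?thesis
      using xy h_closed by (simp add: h_add kernel)
  qed
  from FactGroup_universal[OF h kernel_normal this]
  obtain k where k: "k \<in> hom (F Mod K) (add_monoid G)"
    and k_coset: "\<And>x. x \<in> carrier F \<Longrightarrow> k (K #>\<^bsub>F\<^esub> x) = h x"
    by blast
  have "abelian_group_hom P G k"
    using k by (intro abelian_group_hom_of_additive)
      (auto simp: P.abelian_group_axioms G.abelian_group_axioms tensor_simps hom_def Pi_iff
        simp del: mult_FactGroup)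
  moreover have "k (m \<odot>\<odot> n) = g m n" if "m \<in> carrier M" "n \<in> carrier N" for m n
    using that by (simp add: pure_tensor_def k_coset frag_of_closed h_of)
  ultimately show thesis by (rule that)
qed

text \<open>Closure of \<open>Q\<close> under sums suffices because the negative of a pure tensor is
  again pure, with the sign moved into the left factor.\<close>

lemma tensor_induct [consumes 1, case_names pure zero add]:
  assumes "x \<in> carrier P"
    and pure: "\<And>m n. \<lbrakk>m \<in> carrier M; n \<in> carrier N\<rbrakk> \<Longrightarrow> Q (m \<odot>\<odot> n)"
    and zero: "Q \<zero>\<^bsub>P\<^esub>"
    and add: "\<And>x y. \<lbrakk>x \<in> carrier P; y \<in> carrier P; Q x; Q y\<rbrakk> \<Longrightarrow> Q (x \<oplus>\<^bsub>P\<^esub> y)"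
  shows "Q x"
proof -
  have neg: "\<ominus>\<^bsub>P\<^esub> (m \<odot>\<odot> n) = (\<ominus>\<^bsub>M\<^esub> m) \<odot>\<odot> n" if "m \<in> carrier M" "n \<in> carrier N" for m n
    using abelian_group_hom.hom_a_inv[OF pure_hom_left] that by simp
  obtain y where y: "y \<in> carrier F" "x = K #>\<^bsub>F\<^esub> y"
    using assms(1) by (auto simp: tensor_simps carrier_FactGroup)
  have uminus: "K #>\<^bsub>F\<^esub> (- z) = \<ominus>\<^bsub>P\<^esub> (K #>\<^bsub>F\<^esub> z)" if "z \<in> carrier F" for z
  proof -
    note z = uminus_closed[OF that]
    have "(K #>\<^bsub>F\<^esub> (- z)) \<oplus>\<^bsub>P\<^esub> (K #>\<^bsub>F\<^esub> z) = K #>\<^bsub>F\<^esub> 0"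
      using coset_add[OF z that] by simp
    also have "\<dots> = \<zero>\<^bsub>P\<^esub>"
      using free.coset_mult_one[OF subgroup.subset[OF kernel_subgroup]]
      by (simp add: tensor_simps tensor_free_def)
    finally show ?thesis
      by (rule P.minus_equality[symmetric]) (simp_all add: coset_closed z that)
  qed
  \<comment> \<open>Induction over the free abelian group proceeds by differences, under which
    \<open>Q\<close> is not known to be closed. The claim is therefore strengthened: adding or
    subtracting the coset of \<open>y\<close> preserves \<open>Q\<close> at every \<open>u\<close>.
    A difference is then handled by two successive translations, and \<open>u\<close> = 0 gives the
    result.\<close>
  have "\<forall>u\<in>carrier P. Q u \<longrightarrow> Q (u \<oplus>\<^bsub>P\<^esub> (K #>\<^bsub>F\<^esub> y)) \<and> Q (u \<ominus>\<^bsub>P\<^esub> (K #>\<^bsub>F\<^esub> y))"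
    using y(1)[unfolded tensor_free_def carrier_free_Abelian_group_iff]
  proof (induct y rule: free_Abelian_group_induct[consumes 1, case_names zero diff of])
    case zero
    have "K #>\<^bsub>F\<^esub> 0 = \<zero>\<^bsub>P\<^esub>"
      using free.coset_mult_one[OF subgroup.subset[OF kernel_subgroup]]
      by (simp add: tensor_simps tensor_free_def)
    then show ?case by (simp add: P.minus_eq P.minus_equality[OF P.l_zero])
  next
    case (diff v w)
    then have vw: "v \<in> carrier F" "w \<in> carrier F" by (simp_all add: tensor_free_def)
    have "K #>\<^bsub>F\<^esub> (v - w) = (K #>\<^bsub>F\<^esub> v) \<ominus>\<^bsub>P\<^esub> (K #>\<^bsub>F\<^esub> w)"
      using coset_add[OF vw(1) uminus_closed[OF vw(2)]] by (simp add: uminus[OF vw(2)] P.minus_eq)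
    with diff(3,4) vw show ?case
      by (simp add: P.minus_eq P.minus_add coset_closed P.a_assoc[symmetric])
  next
    case (of p)
    then obtain m n where p: "p = (m, n)" "m \<in> carrier M" "n \<in> carrier N" by auto
    then have "Q (m \<odot>\<odot> n)" "Q (\<ominus>\<^bsub>P\<^esub> (m \<odot>\<odot> n))"
      by (simp_all add: neg pure)
    with p show ?case
      by (auto simp: P.minus_eq pure_closed add simp flip: pure_tensor_def)
  qed
  then show ?thesis
    using zero y P.l_zero[OF coset_closed[OF y(1)]] P.zero_closed by metis
qed

lemma tensor_hom_eqI:
  assumes "abelian_group_hom P G h" "abelian_group_hom P G k" "x \<in> carrier P"
    and "\<And>m n. \<lbrakk>m \<in> carrier M; n \<in> carrier N\<rbrakk> \<Longrightarrow> h (m \<odot>\<odot> n) = k (m \<odot>\<odot> n)"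
  shows "h x = k x"
  using assms(3)
  by (induct rule: tensor_induct)
    (simp_all add: assms(4) abelian_group_hom.hom_zero[OF assms(1)] abelian_group_hom.hom_zero[OF assms(2)]
      abelian_group_hom.hom_add[OF assms(1)] abelian_group_hom.hom_add[OF assms(2)])

section \<open>Functoriality of the tensor product\<close>

context
  fixes f g
  assumes f: "abelian_group_hom M M f" and g: "abelian_group_hom N N g"
    and f_rsmult: "\<And>m r. \<lbrakk>m \<in> carrier M; r \<in> carrier R\<rbrakk> \<Longrightarrow> f (m \<cdot>\<^bsub>M\<^esub> r) = f m \<cdot>\<^bsub>M\<^esub> r"
    and g_smult: "\<And>r n. \<lbrakk>r \<in> carrier R; n \<in> carrier N\<rbrakk> \<Longrightarrow> g (r \<odot>\<^bsub>N\<^esub> n) = r \<odot>\<^bsub>N\<^esub> g n"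
begin

interpretation f: abelian_group_hom M M f by (rule f)
interpretation g: abelian_group_hom N N g by (rule g)

abbreviation (input) "\<Phi> \<equiv> frag_extend (\<lambda>(m, n). frag_of (f m, g n))"

lemma free_map_hom: "group_hom F F \<Phi>"
proof (intro group_hom.intro group_hom_axioms.intro homI)
  show "\<Phi> x \<in> carrier F" if "x \<in> carrier F" for x
    using that[unfolded tensor_free_def carrier_free_Abelian_group_iff]
    by (induct x rule: free_Abelian_group_induct[consumes 1])
      (auto simp: frag_extend_diff intro!: diff_closed frag_of_closed free.one_closed[unfolded one_free])
qed (simp_all add: mult_free frag_extend_add free.is_group)

text \<open>The linear extension sends each relation to a relation of the same kind; for the
  balancing relations this is the linearity of \<open>f\<close> and \<open>g\<close> over R. The
  image of a generated subgroup is generated by the image of its generators.\<close>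

lemma free_map_kernel: "\<Phi> ` K \<subseteq> K"
proof -
  interpret \<Phi>: group_hom F F \<Phi> by (rule free_map_hom)
  have "\<Phi> ` tensor_relations R M N \<subseteq> tensor_relations R M N"
  proof (rule image_subsetI)
    fix x assume "x \<in> tensor_relations R M N"
    then show "\<Phi> x \<in> tensor_relations R M N"
      by cases (simp_all add: frag_extend_diff f_rsmult g_smult tensor_relations.intros)
  qed
  then show ?thesis
    unfolding tensor_kernel_def \<Phi>.generate_img[OF relations_subset, symmetric]
    by (rule free.mono_generate)
qed

lemma tensor_map_coset:
  assumes "x \<in> carrier F"
  shows "tensor_map R M N f g (K #>\<^bsub>F\<^esub> x) = K #>\<^bsub>F\<^esub> \<Phi> x"
proof -
  interpret \<Phi>: group_hom F F \<Phi> by (rule free_map_hom)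
  interpret K: subgroup K F by (rule kernel_subgroup)
  have coset: "K #>\<^bsub>F\<^esub> z = (\<lambda>k. k + z) ` K" for z
    by (auto simp: r_coset_def mult_free)
  have K_add: "k + l \<in> K" if "k \<in> K" "l \<in> K" for k l
    using K.m_closed[OF that] by (simp add: mult_free)
  show ?thesis
  proof (intro equalityI subsetI)
    fix z assume "z \<in> tensor_map R M N f g (K #>\<^bsub>F\<^esub> x)"
    then obtain k l where "k \<in> K" "l \<in> K" "z = k + \<Phi> (l + x)"
      unfolding tensor_map_def set_mult_def coset mult_free by blast
    moreover from this have "k + \<Phi> l \<in> K"
      using free_map_kernel by (intro K_add) auto
    ultimately show "z \<in> K #>\<^bsub>F\<^esub> \<Phi> x"
      by (simp add: coset frag_extend_add image_iff add.assoc)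
  next
    fix z assume "z \<in> K #>\<^bsub>F\<^esub> \<Phi> x"
    then obtain k where k: "k \<in> K" "z = k + \<Phi> x"
      by (auto simp: coset)
    have "x \<in> K #>\<^bsub>F\<^esub> x"
      by (rule free.rcos_self[OF assms kernel_subgroup])
    with k show "z \<in> tensor_map R M N f g (K #>\<^bsub>F\<^esub> x)"
      unfolding tensor_map_def set_mult_def mult_free by blast
  qed
qed

lemma tensor_map_hom: "abelian_group_hom P P (tensor_map R M N f g)"
proof (rule abelian_group_hom_of_additive[OF abelian_group_tensor abelian_group_tensor])
  interpret \<Phi>: group_hom F F \<Phi> by (rule free_map_hom)
  fix c assume "c \<in> carrier P"
  then obtain x where x: "x \<in> carrier F" "c = K #>\<^bsub>F\<^esub> x"
    by (auto simp: tensor_simps carrier_FactGroup)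
  then show "tensor_map R M N f g c \<in> carrier P"
    by (simp add: tensor_map_coset coset_closed)
  fix d assume "d \<in> carrier P"
  then obtain y where y: "y \<in> carrier F" "d = K #>\<^bsub>F\<^esub> y"
    by (auto simp: tensor_simps carrier_FactGroup)
  have "x + y \<in> carrier F" using free.m_closed[of x y] x y by (simp add: mult_free)
  with x y show "tensor_map R M N f g (c \<oplus>\<^bsub>P\<^esub> d) = tensor_map R M N f g c \<oplus>\<^bsub>P\<^esub> tensor_map R M N f g d"
    by (simp add: tensor_map_coset coset_add[symmetric] frag_extend_add)
qed

lemma tensor_map_pure:
  "\<lbrakk>m \<in> carrier M; n \<in> carrier N\<rbrakk> \<Longrightarrow> tensor_map R M N f g (m \<odot>\<odot> n) = f m \<odot>\<odot> g n"
  by (simp add: pure_tensor_def tensor_map_coset frag_of_closed)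

end

end

section \<open>Linear maps and endomorphism rings\<close>

lemma left_hom_extensional: "f \<in> left_hom R M N \<Longrightarrow> f \<in> extensional (carrier M)"
  by (simp add: left_hom_def PiE_def)

lemma left_hom_closed: "\<lbrakk>f \<in> left_hom R M N; x \<in> carrier M\<rbrakk> \<Longrightarrow> f x \<in> carrier N"
  by (auto simp: left_hom_def)

lemma left_hom_add:
  "\<lbrakk>f \<in> left_hom R M N; x \<in> carrier M; y \<in> carrier M\<rbrakk> \<Longrightarrow> f (x \<oplus>\<^bsub>M\<^esub> y) = f x \<oplus>\<^bsub>N\<^esub> f y"
  by (simp add: left_hom_def)

lemma left_hom_smult:
  "\<lbrakk>f \<in> left_hom R M N; r \<in> carrier R; x \<in> carrier M\<rbrakk> \<Longrightarrow> f (r \<odot>\<^bsub>M\<^esub> x) = r \<odot>\<^bsub>N\<^esub> f x"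
  by (simp add: left_hom_def)

lemma left_hom_eqI:
  assumes "f \<in> left_hom R M N" "g \<in> left_hom R M N" "\<And>x. x \<in> carrier M \<Longrightarrow> f x = g x"
  shows "f = g"
  using assms by (auto intro: extensionalityI[of _ "carrier M"] left_hom_extensional)

lemma left_hom_abelian_group_hom:
  assumes "abelian_group M" "abelian_group N" "f \<in> left_hom R M N"
  shows "abelian_group_hom M N f"
  using assms by (intro abelian_group_hom_of_additive) (auto simp: left_hom_add left_hom_closed)

lemma (in left_module) restrict_left_hom:
  assumes "\<And>x. x \<in> carrier M \<Longrightarrow> f x \<in> carrier N"
    and "\<And>x y. \<lbrakk>x \<in> carrier M; y \<in> carrier M\<rbrakk> \<Longrightarrow> f (x \<oplus>\<^bsub>M\<^esub> y) = f x \<oplus>\<^bsub>N\<^esub> f y"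
    and "\<And>r x. \<lbrakk>r \<in> carrier R; x \<in> carrier M\<rbrakk> \<Longrightarrow> f (r \<odot>\<^bsub>M\<^esub> x) = r \<odot>\<^bsub>N\<^esub> f x"
  shows "restrict f (carrier M) \<in> left_hom R M N"
  using assms by (auto simp: left_hom_def smult_closed)

lemma (in left_module) smult_hom: "a \<in> carrier R \<Longrightarrow> abelian_group_hom M M (\<lambda>x. a \<odot>\<^bsub>M\<^esub> x)"
  by (rule abelian_group_hom_of_additive) (simp_all add: M.abelian_group_axioms smult_closed smult_r_distr)

lemma (in left_module) smult_hom_left:
  "x \<in> carrier M \<Longrightarrow> abelian_group_hom R M (\<lambda>a. a \<odot>\<^bsub>M\<^esub> x)"
  by (rule abelian_group_hom_of_additive)
    (simp_all add: R.abelian_group_axioms M.abelian_group_axioms smult_closed smult_l_distr)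

lemma end_ring_simps:
  "carrier (end_ring R M) = left_hom R M M"
  "f \<otimes>\<^bsub>end_ring R M\<^esub> g = compose (carrier M) g f"
  "\<one>\<^bsub>end_ring R M\<^esub> = (\<lambda>x\<in>carrier M. x)"
  "\<zero>\<^bsub>end_ring R M\<^esub> = (\<lambda>x\<in>carrier M. \<zero>\<^bsub>M\<^esub>)"
  "f \<oplus>\<^bsub>end_ring R M\<^esub> g = (\<lambda>x\<in>carrier M. f x \<oplus>\<^bsub>M\<^esub> g x)"
  by (simp_all add: end_ring_def)

section \<open>Endomorphism rings acting from the right\<close>

context left_module
begin

abbreviation "E \<equiv> end_ring R M"

lemma end_closed: "\<lbrakk>f \<in> carrier E; x \<in> carrier M\<rbrakk> \<Longrightarrow> f x \<in> carrier M"
  by (simp add: end_ring_simps left_hom_closed)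

lemma end_hom: "f \<in> carrier E \<Longrightarrow> abelian_group_hom M M f"
  unfolding end_ring_simps by (rule left_hom_abelian_group_hom[OF M.abelian_group_axioms M.abelian_group_axioms])

lemma end_add: "\<lbrakk>f \<in> carrier E; x \<in> carrier M; y \<in> carrier M\<rbrakk> \<Longrightarrow> f (x \<oplus>\<^bsub>M\<^esub> y) = f x \<oplus>\<^bsub>M\<^esub> f y"
  by (simp add: end_ring_simps left_hom_add)

lemma end_smult: "\<lbrakk>f \<in> carrier E; r \<in> carrier R; x \<in> carrier M\<rbrakk> \<Longrightarrow> f (r \<odot>\<^bsub>M\<^esub> x) = r \<odot>\<^bsub>M\<^esub> f x"
  by (simp add: end_ring_simps left_hom_smult)

lemma end_eqI:
  "\<lbrakk>f \<in> carrier E; g \<in> carrier E; \<And>x. x \<in> carrier M \<Longrightarrow> f x = g x\<rbrakk> \<Longrightarrow> f = g"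
  unfolding end_ring_simps by (rule left_hom_eqI)

lemma restrict_end:
  assumes "abelian_group_hom M M f"
    and "\<And>r x. \<lbrakk>r \<in> carrier R; x \<in> carrier M\<rbrakk> \<Longrightarrow> f (r \<odot>\<^bsub>M\<^esub> x) = r \<odot>\<^bsub>M\<^esub> f x"
  shows "restrict f (carrier M) \<in> carrier E"
proof -
  interpret f: abelian_group_hom M M f by fact
  show ?thesis
    unfolding end_ring_simps by (rule restrict_left_hom) (simp_all add: assms(2))
qed

lemma end_ring_apply:
  assumes "x \<in> carrier M"
  shows "(f \<otimes>\<^bsub>E\<^esub> g) x = g (f x)" "\<one>\<^bsub>E\<^esub> x = x" "\<zero>\<^bsub>E\<^esub> x = \<zero>\<^bsub>M\<^esub>" "(f \<oplus>\<^bsub>E\<^esub> g) x = f x \<oplus>\<^bsub>M\<^esub> g x"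
  using assms by (simp_all add: end_ring_simps compose_def)

lemma ring_end_ring: "ring E"
proof -
  have mult: "f \<otimes>\<^bsub>E\<^esub> g \<in> carrier E" if "f \<in> carrier E" "g \<in> carrier E" for f g
    unfolding end_ring_simps(2) compose_def using that
    by (intro restrict_end abelian_group_hom_compose[of M M f M g])
      (simp_all add: end_hom end_smult end_closed)
  have one: "\<one>\<^bsub>E\<^esub> \<in> carrier E"
    unfolding end_ring_simps(3)
    by (rule restrict_end) (simp_all add: abelian_group_hom_of_additive M.abelian_group_axioms)
  have zero: "\<zero>\<^bsub>E\<^esub> \<in> carrier E"
    unfolding end_ring_simps(4)
    by (rule restrict_end)
      (simp_all add: abelian_group_hom_of_additive M.abelian_group_axioms
        abelian_group_hom.hom_zero[OF smult_hom])
  have add: "f \<oplus>\<^bsub>E\<^esub> g \<in> carrier E" if "f \<in> carrier E" "g \<in> carrier E" for f g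
    unfolding end_ring_simps(5) using that
    by (intro restrict_end abelian_group_hom_of_additive)
      (simp_all add: M.abelian_group_axioms end_closed end_add end_smult smult_r_distr M.add.m_ac)
  have neg: "\<exists>g\<in>carrier E. g \<oplus>\<^bsub>E\<^esub> f = \<zero>\<^bsub>E\<^esub>" if f: "f \<in> carrier E" for f
  proof
    show g: "(\<lambda>x\<in>carrier M. \<ominus>\<^bsub>M\<^esub> f x) \<in> carrier E"
      using f by (intro restrict_end abelian_group_hom_of_additive)
        (simp_all add: M.abelian_group_axioms end_closed end_add end_smult M.minus_add
          abelian_group_hom.hom_a_inv[OF smult_hom])
    show "(\<lambda>x\<in>carrier M. \<ominus>\<^bsub>M\<^esub> f x) \<oplus>\<^bsub>E\<^esub> f = \<zero>\<^bsub>E\<^esub>"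
      by (rule end_eqI) (simp_all add: f g add zero end_ring_apply end_closed M.l_neg)
  qed
  show ?thesis
  proof (rule ringI)
    show "abelian_group E"
      by (rule abelian_groupI)
        (auto intro!: end_eqI neg simp: add zero end_ring_apply end_closed M.add.m_ac)
    show "Group.monoid E"
      by (rule monoidI) (auto intro!: end_eqI simp: mult one end_ring_apply end_closed)
  qed (auto intro!: end_eqI simp: mult add end_ring_apply end_closed end_add)
qed

sublocale E: ring E
  by (rule ring_end_ring)

lemma eval_hom: "x \<in> carrier M \<Longrightarrow> abelian_group_hom E M (\<lambda>f. f x)"
  by (rule abelian_group_hom_of_additive)
    (simp_all add: E.abelian_group_axioms M.abelian_group_axioms end_closed end_ring_apply)

lemma end_finsum:
  "\<lbrakk>f \<in> I \<rightarrow> carrier E; x \<in> carrier M\<rbrakk> \<Longrightarrow> (\<Oplus>\<^bsub>E\<^esub>i\<in>I. f i) x = (\<Oplus>\<^bsub>M\<^esub>i\<in>I. f i x)"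
  using abelian_group_hom.hom_finsum[OF eval_hom] by fast

end


section \<open>Free bimodules and dual bases\<close>

lemma free_bimodule_simps:
  "carrier (free_bimodule R I) = {v \<in> I \<rightarrow>\<^sub>E carrier R. finite {i \<in> I. v i \<noteq> \<zero>\<^bsub>R\<^esub>}}"
  "\<zero>\<^bsub>free_bimodule R I\<^esub> = (\<lambda>i\<in>I. \<zero>\<^bsub>R\<^esub>)"
  "v \<oplus>\<^bsub>free_bimodule R I\<^esub> w = (\<lambda>i\<in>I. v i \<oplus>\<^bsub>R\<^esub> w i)"
  "r \<odot>\<^bsub>free_bimodule R I\<^esub> v = (\<lambda>i\<in>I. r \<otimes>\<^bsub>R\<^esub> v i)"
  "v \<cdot>\<^bsub>free_bimodule R I\<^esub> r = (\<lambda>i\<in>I. v i \<otimes>\<^bsub>R\<^esub> r)"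
  by (simp_all add: free_bimodule_def)

lemma carrier_free_bimodule_finite: "finite I \<Longrightarrow> carrier (free_bimodule R I) = I \<rightarrow>\<^sub>E carrier R"
  by (auto simp: free_bimodule_simps)

lemma free_bimodule_closed:
  "\<lbrakk>v \<in> carrier (free_bimodule R I); i \<in> I\<rbrakk> \<Longrightarrow> v i \<in> carrier R"
  by (auto simp: free_bimodule_simps)

lemma free_bimodule_eqI:
  assumes "v \<in> carrier (free_bimodule R I)" "w \<in> carrier (free_bimodule R I)"
    and "\<And>i. i \<in> I \<Longrightarrow> v i = w i"
  shows "v = w"
  using assms by (auto simp: free_bimodule_simps intro: PiE_ext)

definition unit_vector :: "('r, 'x) ring_scheme \<Rightarrow> 'i set \<Rightarrow> 'i \<Rightarrow> 'i \<Rightarrow> 'r"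
  where "unit_vector R I j = (\<lambda>i\<in>I. if i = j then \<one>\<^bsub>R\<^esub> else \<zero>\<^bsub>R\<^esub>)"

section \<open>Free bimodules of finite rank and their standard bases\<close>

context ring
begin

context
  fixes I :: "'i set"
  assumes I: "finite I"
begin

interpretation L: abelian_group "free_bimodule R I"
proof (rule abelian_groupI)
  note [simp] = free_bimodule_closed[of _ R I]
  have zero: "\<zero>\<^bsub>free_bimodule R I\<^esub> \<in> carrier (free_bimodule R I)"
    using I by (simp add: carrier_free_bimodule_finite free_bimodule_simps(2))
  then show "\<zero>\<^bsub>free_bimodule R I\<^esub> \<in> carrier (free_bimodule R I)" .
  have add: "v \<oplus>\<^bsub>free_bimodule R I\<^esub> w \<in> carrier (free_bimodule R I)"
    if "v \<in> carrier (free_bimodule R I)" "w \<in> carrier (free_bimodule R I)" for v w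
    using that I by (auto simp: carrier_free_bimodule_finite free_bimodule_simps(3))
  then show "v \<oplus>\<^bsub>free_bimodule R I\<^esub> w \<in> carrier (free_bimodule R I)"
    if "v \<in> carrier (free_bimodule R I)" "w \<in> carrier (free_bimodule R I)" for v w
    using that .
  fix v assume v: "v \<in> carrier (free_bimodule R I)"
  show "\<exists>w\<in>carrier (free_bimodule R I). w \<oplus>\<^bsub>free_bimodule R I\<^esub> v = \<zero>\<^bsub>free_bimodule R I\<^esub>"
  proof
    show "(\<lambda>i\<in>I. \<ominus> v i) \<in> carrier (free_bimodule R I)"
      using v I by (simp add: carrier_free_bimodule_finite PiE_mem)
    then show "(\<lambda>i\<in>I. \<ominus> v i) \<oplus>\<^bsub>free_bimodule R I\<^esub> v = \<zero>\<^bsub>free_bimodule R I\<^esub>"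
      using v by (intro free_bimodule_eqI[of _ R I] add zero) (simp_all add: free_bimodule_simps(2,3) l_neg)
  qed
  show "\<zero>\<^bsub>free_bimodule R I\<^esub> \<oplus>\<^bsub>free_bimodule R I\<^esub> v = v"
    using v by (intro free_bimodule_eqI[of _ R I] add zero) (simp_all add: free_bimodule_simps(2,3))
  fix w assume w: "w \<in> carrier (free_bimodule R I)"
  show "v \<oplus>\<^bsub>free_bimodule R I\<^esub> w = w \<oplus>\<^bsub>free_bimodule R I\<^esub> v"
    using v w by (intro free_bimodule_eqI[of _ R I] add) (simp_all add: free_bimodule_simps(3) a_comm)
  fix u assume u: "u \<in> carrier (free_bimodule R I)"
  show "v \<oplus>\<^bsub>free_bimodule R I\<^esub> w \<oplus>\<^bsub>free_bimodule R I\<^esub> u = v \<oplus>\<^bsub>free_bimodule R I\<^esub> (w \<oplus>\<^bsub>free_bimodule R I\<^esub> u)"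
    using u v w by (intro free_bimodule_eqI[of _ R I] add) (simp_all add: free_bimodule_simps(3) a_assoc)
qed

lemma free_bimodule_smult_closed:
  "\<lbrakk>r \<in> carrier R; v \<in> carrier (free_bimodule R I)\<rbrakk> \<Longrightarrow>
    r \<odot>\<^bsub>free_bimodule R I\<^esub> v \<in> carrier (free_bimodule R I)"
  using I by (auto simp: carrier_free_bimodule_finite free_bimodule_simps(4))

lemma free_bimodule_rsmult_closed:
  "\<lbrakk>r \<in> carrier R; v \<in> carrier (free_bimodule R I)\<rbrakk> \<Longrightarrow>
    v \<cdot>\<^bsub>free_bimodule R I\<^esub> r \<in> carrier (free_bimodule R I)"
  using I by (auto simp: carrier_free_bimodule_finite free_bimodule_simps(5))

lemma left_module_free_bimodule: "left_module R (free_bimodule R I)"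
proof (intro left_module.intro left_module_axioms.intro ring_axioms L.abelian_group_axioms
    free_bimodule_smult_closed)
  note [simp] = free_bimodule_closed[of _ R I]
  fix v assume v: "v \<in> carrier (free_bimodule R I)"
  show "\<one> \<odot>\<^bsub>free_bimodule R I\<^esub> v = v"
    using v by (intro free_bimodule_eqI[of _ R I] free_bimodule_smult_closed) (simp_all add: free_bimodule_simps(4))
  fix a assume a: "a \<in> carrier R"
  show "a \<odot>\<^bsub>free_bimodule R I\<^esub> (v \<oplus>\<^bsub>free_bimodule R I\<^esub> w) =
      a \<odot>\<^bsub>free_bimodule R I\<^esub> v \<oplus>\<^bsub>free_bimodule R I\<^esub> a \<odot>\<^bsub>free_bimodule R I\<^esub> w"
    if "w \<in> carrier (free_bimodule R I)" for w
    using a v that by (intro free_bimodule_eqI[of _ R I] free_bimodule_smult_closed L.a_closed)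
      (simp_all add: free_bimodule_simps(3,4) r_distr)
  fix b assume b: "b \<in> carrier R"
  show "(a \<oplus> b) \<odot>\<^bsub>free_bimodule R I\<^esub> v = a \<odot>\<^bsub>free_bimodule R I\<^esub> v \<oplus>\<^bsub>free_bimodule R I\<^esub> b \<odot>\<^bsub>free_bimodule R I\<^esub> v"
    using a b v by (intro free_bimodule_eqI[of _ R I] free_bimodule_smult_closed L.a_closed)
      (simp_all add: free_bimodule_simps(3,4) l_distr)
  show "(a \<otimes> b) \<odot>\<^bsub>free_bimodule R I\<^esub> v = a \<odot>\<^bsub>free_bimodule R I\<^esub> (b \<odot>\<^bsub>free_bimodule R I\<^esub> v)"
    using a b v by (intro free_bimodule_eqI[of _ R I] free_bimodule_smult_closed)
      (simp_all add: free_bimodule_simps(4) m_assoc)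
qed

lemma free_bimodule_rsmult_add:
  assumes "r \<in> carrier R" "v \<in> carrier (free_bimodule R I)" "w \<in> carrier (free_bimodule R I)"
  shows "(v \<oplus>\<^bsub>free_bimodule R I\<^esub> w) \<cdot>\<^bsub>free_bimodule R I\<^esub> r =
    v \<cdot>\<^bsub>free_bimodule R I\<^esub> r \<oplus>\<^bsub>free_bimodule R I\<^esub> w \<cdot>\<^bsub>free_bimodule R I\<^esub> r"
  using assms I
  by (intro free_bimodule_eqI[of _ R I] free_bimodule_rsmult_closed L.a_closed)
    (simp_all add: free_bimodule_simps(3,5) free_bimodule_closed[of _ R I] l_distr)

lemma free_bimodule_apply_hom: "i \<in> I \<Longrightarrow> abelian_group_hom (free_bimodule R I) R (\<lambda>v. v i)"
  by (rule abelian_group_hom_of_additive[OF L.abelian_group_axioms abelian_group_axioms])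
    (simp_all add: free_bimodule_closed[of _ R I] free_bimodule_simps(3))

lemma unit_vector_closed: "unit_vector R I j \<in> carrier (free_bimodule R I)"
  using I by (auto simp: unit_vector_def carrier_free_bimodule_finite)

text \<open>The entries zero and one commute with every scalar. The elements \<open>c i\<close> of
  the Frobenius system inherit their commutation with R from this.\<close>

lemma unit_vector_central:
  "r \<in> carrier R \<Longrightarrow>
    r \<odot>\<^bsub>free_bimodule R I\<^esub> unit_vector R I j = unit_vector R I j \<cdot>\<^bsub>free_bimodule R I\<^esub> r"
  by (auto simp: unit_vector_def free_bimodule_simps(4,5) intro!: restrict_ext)

lemma unit_vector_expansion:
  assumes v: "v \<in> carrier (free_bimodule R I)"
  shows "(\<Oplus>\<^bsub>free_bimodule R I\<^esub>j\<in>I. v j \<odot>\<^bsub>free_bimodule R I\<^esub> unit_vector R I j) = v"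
proof (rule free_bimodule_eqI[of _ R I])
  let ?e = "\<lambda>j. v j \<odot>\<^bsub>free_bimodule R I\<^esub> unit_vector R I j"
  have v_closed: "v j \<in> carrier R" if "j \<in> I" for j
    using free_bimodule_closed v that .
  have summand: "?e \<in> I \<rightarrow> carrier (free_bimodule R I)"
    by (intro funcsetI free_bimodule_smult_closed unit_vector_closed v_closed)
  then show "(\<Oplus>\<^bsub>free_bimodule R I\<^esub>j\<in>I. ?e j) \<in> carrier (free_bimodule R I)"
    by (rule L.finsum_closed)
  fix i assume i: "i \<in> I"
  have "(\<Oplus>\<^bsub>free_bimodule R I\<^esub>j\<in>I. ?e j) i = (\<Oplus>j\<in>I. ?e j i)"
    using summand by (rule abelian_group_hom.hom_finsum[OF free_bimodule_apply_hom[OF i]])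
  also have "\<dots> = (\<Oplus>j\<in>I. if i = j then v j else \<zero>)"
    using i v_closed by (intro finsum_cong') (auto simp: free_bimodule_simps(4) unit_vector_def)
  finally show "(\<Oplus>\<^bsub>free_bimodule R I\<^esub>j\<in>I. ?e j) i = v i"
    using i I v_closed by (simp add: add.finprod_singleton)
qed (rule v)

end

end

lemma set_add_memI: "\<lbrakk>h \<in> H; k \<in> K\<rbrakk> \<Longrightarrow> h \<oplus>\<^bsub>G\<^esub> k \<in> H <+>\<^bsub>G\<^esub> K"
  by (auto simp: set_add_def')

section \<open>Modules with a finite dual basis\<close>

context left_module
begin

lemma submodule_image:
  assumes "left_module R N" "f \<in> left_hom R M N"
  shows "submodule (f ` carrier M) R N"
proof -
  interpret N: left_module R N by fact
  interpret f: abelian_group_hom M N f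
    using assms M.abelian_group_axioms N.M.abelian_group_axioms by (rule_tac left_hom_abelian_group_hom)
  show ?thesis
  proof (intro submodule.intro submodule_axioms.intro)
    show "subgroup (f ` carrier M) (add_monoid N)"
      using group_hom.subgroup_img_is_subgroup[OF f.a_group_hom M.add.subgroup_self] by simp
    show "a \<odot>\<^bsub>N\<^esub> y \<in> f ` carrier M" if "a \<in> carrier R" "y \<in> f ` carrier M" for a y
      using that assms(2) by (auto simp: smult_closed simp flip: left_hom_smult)
  qed
qed

lemma submodule_kernel:
  assumes "left_module R N" "f \<in> left_hom R M N"
  shows "submodule {x \<in> carrier M. f x = \<zero>\<^bsub>N\<^esub>} R M"
proof -
  interpret N: left_module R N by fact
  interpret f: abelian_group_hom M N f
    using assms M.abelian_group_axioms N.M.abelian_group_axioms by (rule_tac left_hom_abelian_group_hom)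
  show ?thesis
  proof (intro submodule.intro submodule_axioms.intro)
    show "subgroup {x \<in> carrier M. f x = \<zero>\<^bsub>N\<^esub>} (add_monoid M)"
      using group_hom.subgroup_kernel[OF f.a_group_hom] by (simp add: kernel_def)
    show "a \<odot>\<^bsub>M\<^esub> y \<in> {x \<in> carrier M. f x = \<zero>\<^bsub>N\<^esub>}"
      if "a \<in> carrier R" "y \<in> {x \<in> carrier M. f x = \<zero>\<^bsub>N\<^esub>}" for a y
      using that assms(2) by (simp add: smult_closed left_hom_smult abelian_group_hom.hom_zero[OF N.smult_hom])
  qed
qed

text \<open>The expansion writes each element as a linear combination of the \<open>c i\<close>, so
  a submodule containing these is everything.\<close>

lemma finitely_generated_of_dual_basis:
  assumes "finite I" "c \<in> I \<rightarrow> carrier M"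
    and f_closed: "\<And>i x. \<lbrakk>i \<in> I; x \<in> carrier M\<rbrakk> \<Longrightarrow> f i x \<in> carrier R"
    and basis: "\<And>x. x \<in> carrier M \<Longrightarrow> x = (\<Oplus>\<^bsub>M\<^esub>i\<in>I. f i x \<odot>\<^bsub>M\<^esub> c i)"
  shows "finitely_generated R M"
  unfolding finitely_generated_def
proof (intro exI conjI allI impI)
  show "finite (c ` I)" using assms(1) by simp
  show "c ` I \<subseteq> carrier M" using assms(2) by auto
  fix H assume H: "submodule H R M \<and> c ` I \<subseteq> H"
  interpret H: submodule H R M using H by blast
  have "x \<in> H" if "x \<in> carrier M" for x
    using that H
    by (subst basis[OF that])
      (auto intro!: finsum_in_subgroup[OF M.abelian_group_axioms H.subgroup_axioms] H.smult_closed f_closed)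
  then show "H = carrier M"
    using H.subset by auto
qed

text \<open>The definition of projectivity wants a free module on a set of elements of \<open>M\<close>, so the
  coordinates of equal members of the dual basis are added up first.\<close>

lemma projective_of_dual_basis:
  assumes "finite I" "c \<in> I \<rightarrow> carrier M"
    and f: "\<And>i. i \<in> I \<Longrightarrow> abelian_group_hom M R (f i)"
    and f_smult: "\<And>i r x. \<lbrakk>i \<in> I; r \<in> carrier R; x \<in> carrier M\<rbrakk> \<Longrightarrow> f i (r \<odot>\<^bsub>M\<^esub> x) = r \<otimes> f i x"
    and basis: "\<And>x. x \<in> carrier M \<Longrightarrow> x = (\<Oplus>\<^bsub>M\<^esub>i\<in>I. f i x \<odot>\<^bsub>M\<^esub> c i)"
  shows "projective R M"
proof -
  define J where "J = c ` I"
  define g where "g j x = (\<Oplus>i\<in>{i \<in> I. c i = j}. f i x)" for j x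
  let ?L = "free_bimodule R J"
  have J: "finite J" "J \<subseteq> carrier M" using assms(1,2) by (auto simp: J_def)
  interpret L: left_module R ?L by (rule R.left_module_free_bimodule[OF J(1)])
  have f_closed: "f i x \<in> carrier R" if "i \<in> I" "x \<in> carrier M" for i x
    using abelian_group_hom.hom_closed[OF f] that by blast
  have g: "abelian_group_hom M R (g j)" for j
    unfolding g_def
    by (rule abelian_group_hom_finsum) (simp_all add: M.abelian_group_axioms R.abelian_group_axioms f)
  interpret g: abelian_group_hom M R "g j" for j by (rule g)
  have g_smult: "g j (r \<odot>\<^bsub>M\<^esub> x) = r \<otimes> g j x" if "r \<in> carrier R" "x \<in> carrier M" for j r x
    unfolding g_def using that assms(1)
    by (subst R.finsum_rdistr) (auto simp: f_closed f_smult intro!: R.finsum_cong')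
  have basis': "(\<Oplus>\<^bsub>M\<^esub>j\<in>J. g j x \<odot>\<^bsub>M\<^esub> j) = x" if x: "x \<in> carrier M" for x
  proof -
    have "x = (\<Oplus>\<^bsub>M\<^esub>j\<in>J. \<Oplus>\<^bsub>M\<^esub>i\<in>{i \<in> I. c i = j}. f i x \<odot>\<^bsub>M\<^esub> c i)"
      unfolding J_def using x assms(1,2)
      by (subst M.finsum_fibres[symmetric]) (auto simp: f_closed simp flip: basis intro!: smult_closed)
    also have "\<dots> = (\<Oplus>\<^bsub>M\<^esub>j\<in>J. g j x \<odot>\<^bsub>M\<^esub> j)"
    proof (intro M.finsum_cong' refl)
      fix j assume "j \<in> J"
      then have j: "j \<in> carrier M" using J by auto
      have "g j x \<odot>\<^bsub>M\<^esub> j = (\<Oplus>\<^bsub>M\<^esub>i\<in>{i \<in> I. c i = j}. f i x \<odot>\<^bsub>M\<^esub> j)"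
        unfolding g_def using x
        by (intro abelian_group_hom.hom_finsum[OF smult_hom_left[OF j]]) (auto simp: f_closed)
      also have "\<dots> = (\<Oplus>\<^bsub>M\<^esub>i\<in>{i \<in> I. c i = j}. f i x \<odot>\<^bsub>M\<^esub> c i)"
        using x j by (intro M.finsum_cong') (auto simp: f_closed smult_closed)
      finally show "(\<Oplus>\<^bsub>M\<^esub>i\<in>{i \<in> I. c i = j}. f i x \<odot>\<^bsub>M\<^esub> c i) = g j x \<odot>\<^bsub>M\<^esub> j" ..
    qed (use J x in \<open>auto simp: smult_closed\<close>)
    finally show ?thesis ..
  qed
  \<comment> \<open>\<open>\<sigma>\<close> takes coordinates and \<open>\<pi>\<close> forms linear
    combinations. Since \<open>\<pi>\<close> after \<open>\<sigma>\<close> is the identity, the free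
    module is the direct sum of the image of \<open>\<sigma>\<close>, a copy of M, and the kernel of
    \<open>\<pi>\<close>.\<close>
  define \<sigma> where "\<sigma> = (\<lambda>x\<in>carrier M. \<lambda>j\<in>J. g j x)"
  define \<pi> where "\<pi> = (\<lambda>v\<in>carrier ?L. \<Oplus>\<^bsub>M\<^esub>j\<in>J. v j \<odot>\<^bsub>M\<^esub> j)"
  have L: "carrier ?L = J \<rightarrow>\<^sub>E carrier R" by (rule carrier_free_bimodule_finite[OF J(1)])
  have \<sigma>: "\<sigma> \<in> left_hom R M ?L"
    unfolding \<sigma>_def
    by (rule restrict_left_hom)
      (auto simp: L free_bimodule_simps(3,4) g_smult intro!: restrict_ext)
  have \<pi>: "\<pi> \<in> left_hom R ?L M"
    unfolding \<pi>_def
  proof (rule L.restrict_left_hom)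
    fix v w assume v: "v \<in> carrier ?L" and w: "w \<in> carrier ?L"
    then have vw: "v j \<in> carrier R" "w j \<in> carrier R" if "j \<in> J" for j using that by (auto simp: L)
    show "(\<Oplus>\<^bsub>M\<^esub>j\<in>J. v j \<odot>\<^bsub>M\<^esub> j) \<in> carrier M"
      using vw J by (auto intro!: M.finsum_closed smult_closed)
    have "(\<Oplus>\<^bsub>M\<^esub>j\<in>J. (v \<oplus>\<^bsub>?L\<^esub> w) j \<odot>\<^bsub>M\<^esub> j) = (\<Oplus>\<^bsub>M\<^esub>j\<in>J. v j \<odot>\<^bsub>M\<^esub> j \<oplus>\<^bsub>M\<^esub> w j \<odot>\<^bsub>M\<^esub> j)"
      using vw J by (intro M.finsum_cong') (auto simp: free_bimodule_simps(3) smult_l_distr smult_closed)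
    also have "\<dots> = (\<Oplus>\<^bsub>M\<^esub>j\<in>J. v j \<odot>\<^bsub>M\<^esub> j) \<oplus>\<^bsub>M\<^esub> (\<Oplus>\<^bsub>M\<^esub>j\<in>J. w j \<odot>\<^bsub>M\<^esub> j)"
      using vw J by (intro M.finsum_addf) (auto simp: smult_closed)
    finally show "(\<Oplus>\<^bsub>M\<^esub>j\<in>J. (v \<oplus>\<^bsub>?L\<^esub> w) j \<odot>\<^bsub>M\<^esub> j) = \<dots>" .
    fix r assume r: "r \<in> carrier R"
    have "r \<odot>\<^bsub>M\<^esub> (\<Oplus>\<^bsub>M\<^esub>j\<in>J. v j \<odot>\<^bsub>M\<^esub> j) = (\<Oplus>\<^bsub>M\<^esub>j\<in>J. r \<odot>\<^bsub>M\<^esub> (v j \<odot>\<^bsub>M\<^esub> j))"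
      using vw J by (intro abelian_group_hom.hom_finsum[OF smult_hom[OF r]]) (auto simp: smult_closed)
    also have "\<dots> = (\<Oplus>\<^bsub>M\<^esub>j\<in>J. (r \<odot>\<^bsub>?L\<^esub> v) j \<odot>\<^bsub>M\<^esub> j)"
      using vw J r by (intro M.finsum_cong') (auto simp: free_bimodule_simps(4) smult_assoc1 smult_closed)
    finally show "(\<Oplus>\<^bsub>M\<^esub>j\<in>J. (r \<odot>\<^bsub>?L\<^esub> v) j \<odot>\<^bsub>M\<^esub> j) = r \<odot>\<^bsub>M\<^esub> (\<Oplus>\<^bsub>M\<^esub>j\<in>J. v j \<odot>\<^bsub>M\<^esub> j)" ..
  qed
  have \<pi>\<sigma>: "\<pi> (\<sigma> x) = x" if "x \<in> carrier M" for x
  proof -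
    have "\<pi> (\<sigma> x) = (\<Oplus>\<^bsub>M\<^esub>j\<in>J. \<sigma> x j \<odot>\<^bsub>M\<^esub> j)"
      using that left_hom_closed[OF \<sigma>] by (simp add: \<pi>_def)
    also have "\<dots> = (\<Oplus>\<^bsub>M\<^esub>j\<in>J. g j x \<odot>\<^bsub>M\<^esub> j)"
      using that J by (intro M.finsum_cong') (auto simp: \<sigma>_def smult_closed)
    finally show ?thesis using basis' that by simp
  qed
  interpret \<sigma>: abelian_group_hom M ?L \<sigma>
    by (rule left_hom_abelian_group_hom[OF M.abelian_group_axioms L.M.abelian_group_axioms \<sigma>])
  interpret \<pi>: abelian_group_hom ?L M \<pi>
    by (rule left_hom_abelian_group_hom[OF L.M.abelian_group_axioms M.abelian_group_axioms \<pi>])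
  let ?H = "\<sigma> ` carrier M" and ?K = "{v \<in> carrier ?L. \<pi> v = \<zero>\<^bsub>M\<^esub>}"
  have "module_summand ?H R ?L"
    unfolding module_summand_def
  proof (intro conjI exI)
    show "submodule ?H R ?L"
      using L.left_module_axioms \<sigma> by (rule submodule_image)
    show "submodule ?K R ?L"
      using left_module_axioms \<pi> by (rule L.submodule_kernel)
    have "v = \<zero>\<^bsub>?L\<^esub>" if "v \<in> ?H \<inter> ?K" for v
      using that by (auto simp: \<pi>\<sigma>)
    moreover have "\<zero>\<^bsub>?L\<^esub> \<in> ?H \<inter> ?K"
      using imageI[OF M.zero_closed, of \<sigma>] by simp
    ultimately show "?H \<inter> ?K = {\<zero>\<^bsub>?L\<^esub>}" by blast
    have "v \<in> ?H <+>\<^bsub>?L\<^esub> ?K" if v: "v \<in> carrier ?L" for v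
    proof -
      have "v = \<sigma> (\<pi> v) \<oplus>\<^bsub>?L\<^esub> (v \<ominus>\<^bsub>?L\<^esub> \<sigma> (\<pi> v))"
        using v by (simp add: L.M.minus_eq L.M.add.m_lcomm[of _ v] L.M.r_neg)
      also have "\<dots> \<in> ?H <+>\<^bsub>?L\<^esub> ?K"
      proof (rule set_add_memI)
        show "v \<ominus>\<^bsub>?L\<^esub> \<sigma> (\<pi> v) \<in> ?K"
          using v by (simp add: L.M.minus_eq \<pi>\<sigma> M.r_neg)
      qed (use v in simp)
      finally show ?thesis .
    qed
    then show "?H <+>\<^bsub>?L\<^esub> ?K = carrier ?L"
      by (auto simp: set_add_def')
  qed
  moreover have "left_iso R M (?L\<lparr>carrier := ?H\<rparr>)"
    unfolding left_iso_def
  proof (intro bexI)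
    show "bij_betw \<sigma> (carrier M) (carrier (?L\<lparr>carrier := ?H\<rparr>))"
      using \<pi>\<sigma> by (auto simp: bij_betw_def intro: inj_on_inverseI)
    show "\<sigma> \<in> left_hom R M (?L\<lparr>carrier := ?H\<rparr>)"
      using \<sigma> by (auto simp: left_hom_def)
  qed
  ultimately show ?thesis
    unfolding projective_def by blast
qed

end

section \<open>Frobenius systems\<close>

lemma ring_bimodule_simps:
  "carrier (ring_bimodule A f g) = carrier A"
  "\<zero>\<^bsub>ring_bimodule A f g\<^esub> = \<zero>\<^bsub>A\<^esub>"
  "x \<oplus>\<^bsub>ring_bimodule A f g\<^esub> y = x \<oplus>\<^bsub>A\<^esub> y"
  "r \<odot>\<^bsub>ring_bimodule A f g\<^esub> x = f r \<otimes>\<^bsub>A\<^esub> x"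
  "x \<cdot>\<^bsub>ring_bimodule A f g\<^esub> s = x \<otimes>\<^bsub>A\<^esub> g s"
  by (simp_all add: ring_bimodule_def)

lemma hom_bimodule_simps:
  "carrier (hom_bimodule R M N) = left_hom R M N"
  "a \<odot>\<^bsub>hom_bimodule R M N\<^esub> h = (\<lambda>x\<in>carrier M. h (x \<cdot>\<^bsub>M\<^esub> a))"
  "h \<oplus>\<^bsub>hom_bimodule R M N\<^esub> k = (\<lambda>x\<in>carrier M. h x \<oplus>\<^bsub>N\<^esub> k x)"
  "h \<cdot>\<^bsub>hom_bimodule R M N\<^esub> s = (\<lambda>x\<in>carrier M. h x \<cdot>\<^bsub>N\<^esub> s)"
  by (simp_all add: hom_bimodule_def)

context ring
begin

lemma abelian_group_ring_bimodule: "abelian_group (ring_bimodule R f g)"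
  by (rule abelian_groupI) (auto simp: ring_bimodule_simps a_ac intro: add.l_inv_ex[simplified])

lemma finsum_ring_bimodule:
  assumes "h \<in> I \<rightarrow> carrier R"
  shows "(\<Oplus>\<^bsub>ring_bimodule R f g\<^esub>i\<in>I. h i) = (\<Oplus>i\<in>I. h i)"
proof -
  have "abelian_group_hom R (ring_bimodule R f g) (\<lambda>x. x)"
    by (rule abelian_group_hom_of_additive)
      (simp_all add: abelian_group_axioms abelian_group_ring_bimodule ring_bimodule_simps)
  from abelian_group_hom.hom_finsum[OF this assms] show ?thesis ..
qed

end

lemma (in ring_hom_ring) left_module_ring_bimodule: "left_module R (ring_bimodule S h g)"
  by (intro left_module.intro left_module_axioms.intro R.ring_axioms S.abelian_group_ring_bimodule)
    (simp_all add: ring_bimodule_simps S.l_distr S.r_distr S.m_assoc)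

locale frobenius_system = \<iota>?: ring_hom_ring R A \<iota>
  for R :: "('r, 'x) ring_scheme" and A :: "('a, 'y) ring_scheme" and \<iota> +
  fixes E :: "'a \<Rightarrow> 'r" and I :: "'i set" and c d :: "'i \<Rightarrow> 'a"
  assumes finite_I: "finite I"
    and c_closed: "i \<in> I \<Longrightarrow> c i \<in> carrier A"
    and d_closed: "i \<in> I \<Longrightarrow> d i \<in> carrier A"
    and E_closed: "a \<in> carrier A \<Longrightarrow> E a \<in> carrier R"
    and E_add: "\<lbrakk>a \<in> carrier A; b \<in> carrier A\<rbrakk> \<Longrightarrow> E (a \<oplus>\<^bsub>A\<^esub> b) = E a \<oplus>\<^bsub>R\<^esub> E b"
    and E_left: "\<lbrakk>r \<in> carrier R; a \<in> carrier A\<rbrakk> \<Longrightarrow> E (\<iota> r \<otimes>\<^bsub>A\<^esub> a) = r \<otimes>\<^bsub>R\<^esub> E a"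
    and E_right: "\<lbrakk>r \<in> carrier R; a \<in> carrier A\<rbrakk> \<Longrightarrow> E (a \<otimes>\<^bsub>A\<^esub> \<iota> r) = E a \<otimes>\<^bsub>R\<^esub> r"
    and left_basis: "a \<in> carrier A \<Longrightarrow> (\<Oplus>\<^bsub>A\<^esub>i\<in>I. \<iota> (E (a \<otimes>\<^bsub>A\<^esub> d i)) \<otimes>\<^bsub>A\<^esub> c i) = a"
    and right_basis: "a \<in> carrier A \<Longrightarrow> (\<Oplus>\<^bsub>A\<^esub>i\<in>I. d i \<otimes>\<^bsub>A\<^esub> \<iota> (E (c i \<otimes>\<^bsub>A\<^esub> a))) = a"
begin

lemma E_hom: "abelian_group_hom A R E"
  by (rule abelian_group_hom_of_additive)
    (simp_all add: R.abelian_group_axioms S.abelian_group_axioms E_closed E_add)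

text \<open>\<open>left_basis\<close> is a dual basis with generators \<open>c i\<close> and
  coordinates E(a d_i), which gives finite generation and projectivity. For the duality, a is sent
  to x \<mapsto> E(x a): \<open>right_basis\<close> makes this map injective, and
  \<open>left_basis\<close> makes it surjective.\<close>

theorem frobenius_extension: "frobenius_extension R A \<iota>"
  unfolding frobenius_extension_def
proof (intro conjI)
  show "ring_hom_ring R A \<iota>"
    by (rule is_ring_hom_ring)
  interpret A: left_module R "ring_bimodule A \<iota> \<iota>"
    by (rule left_module_ring_bimodule)
  have basis: "a = (\<Oplus>\<^bsub>ring_bimodule A \<iota> \<iota>\<^esub>i\<in>I. E (a \<otimes>\<^bsub>A\<^esub> d i) \<odot>\<^bsub>ring_bimodule A \<iota> \<iota>\<^esub> c i)"
    if "a \<in> carrier (ring_bimodule A \<iota> \<iota>)" for a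
    using that
    by (subst S.finsum_ring_bimodule)
      (auto simp: ring_bimodule_simps left_basis E_closed c_closed d_closed)
  have c: "c \<in> I \<rightarrow> carrier (ring_bimodule A \<iota> \<iota>)"
    by (simp add: ring_bimodule_simps c_closed)
  show "finitely_generated R (ring_bimodule A \<iota> \<iota>)"
    by (rule A.finitely_generated_of_dual_basis[OF finite_I c _ basis])
      (simp_all add: ring_bimodule_simps E_closed d_closed)
  show "projective R (ring_bimodule A \<iota> \<iota>)"
  proof (rule A.projective_of_dual_basis[OF finite_I c _ _ basis])
    fix i assume i: "i \<in> I"
    show "abelian_group_hom (ring_bimodule A \<iota> \<iota>) R (\<lambda>a. E (a \<otimes>\<^bsub>A\<^esub> d i))"
      using i by (intro abelian_group_hom_of_additive)
        (simp_all add: A.M.abelian_group_axioms R.abelian_group_axioms ring_bimodule_simps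
          E_closed E_add d_closed S.l_distr)
    fix r a assume "r \<in> carrier R" "a \<in> carrier (ring_bimodule A \<iota> \<iota>)"
    with i show "E (r \<odot>\<^bsub>ring_bimodule A \<iota> \<iota>\<^esub> a \<otimes>\<^bsub>A\<^esub> d i) = r \<otimes>\<^bsub>R\<^esub> E (a \<otimes>\<^bsub>A\<^esub> d i)"
      by (simp add: ring_bimodule_simps d_closed S.m_assoc E_left)
  qed
  let ?H = "hom_bimodule R (ring_bimodule A \<iota> id) (ring_bimodule R id id)"
  define \<phi> where "\<phi> = (\<lambda>a\<in>carrier A. \<lambda>x\<in>carrier A. E (x \<otimes>\<^bsub>A\<^esub> a))"
  have \<phi>_closed: "\<phi> a \<in> carrier ?H" if "a \<in> carrier A" for a
    using that by (auto simp: \<phi>_def hom_bimodule_simps left_hom_def ring_bimodule_simps E_closed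
        E_add E_left S.l_distr S.m_assoc)
  have "inj_on \<phi> (carrier A)"
  proof (rule inj_onI)
    fix a b assume ab: "a \<in> carrier A" "b \<in> carrier A" "\<phi> a = \<phi> b"
    \<comment> \<open>By \<open>right_basis\<close>, an element is recovered from the values of its
      functional at the \<open>c i\<close>.\<close>
    have "E (c i \<otimes>\<^bsub>A\<^esub> a) = E (c i \<otimes>\<^bsub>A\<^esub> b)" if "i \<in> I" for i
      using fun_cong[OF ab(3), of "c i"] ab(1,2) c_closed[OF that] by (simp add: \<phi>_def)
    then have "(\<Oplus>\<^bsub>A\<^esub>i\<in>I. d i \<otimes>\<^bsub>A\<^esub> \<iota> (E (c i \<otimes>\<^bsub>A\<^esub> a))) = (\<Oplus>\<^bsub>A\<^esub>i\<in>I. d i \<otimes>\<^bsub>A\<^esub> \<iota> (E (c i \<otimes>\<^bsub>A\<^esub> b)))"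
      using ab(2) by (intro S.finsum_cong') (auto simp: c_closed d_closed E_closed)
    then show "a = b"
      using ab by (simp add: right_basis)
  qed
  moreover have "\<phi> ` carrier A = carrier ?H"
  proof (intro equalityI subsetI)
    fix g assume "g \<in> carrier ?H"
    then have g: "g \<in> left_hom R (ring_bimodule A \<iota> id) (ring_bimodule R id id)"
      by (simp add: hom_bimodule_simps)
    have g_closed: "g x \<in> carrier R" if "x \<in> carrier A" for x
      using left_hom_closed[OF g] that by (simp add: ring_bimodule_simps)
    have g_hom: "abelian_group_hom A R g"
      using left_hom_add[OF g] g_closed
      by (intro abelian_group_hom_of_additive)
        (simp_all add: R.abelian_group_axioms S.abelian_group_axioms ring_bimodule_simps)
    \<comment> \<open>The only candidate for a preimage: if g(x) = E(x a) for all x, then g(c_i) =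
      E(c_i a), and \<open>right_basis\<close> yields this sum.\<close>
    define a where "a = (\<Oplus>\<^bsub>A\<^esub>i\<in>I. d i \<otimes>\<^bsub>A\<^esub> \<iota> (g (c i)))"
    have a: "a \<in> carrier A"
      unfolding a_def by (intro S.finsum_closed) (auto simp: c_closed d_closed g_closed)
    \<comment> \<open>By linearity of \<open>E\<close> and of \<open>g\<close>, E(x a) is the sum of
      the E(x d_i) g(c_i), which is \<open>g\<close> applied to the \<open>left_basis\<close>
      expansion of \<open>x\<close>.\<close>
    have "E (x \<otimes>\<^bsub>A\<^esub> a) = g x" if x: "x \<in> carrier A" for x
    proof -
      have "E (x \<otimes>\<^bsub>A\<^esub> a) = E (\<Oplus>\<^bsub>A\<^esub>i\<in>I. x \<otimes>\<^bsub>A\<^esub> (d i \<otimes>\<^bsub>A\<^esub> \<iota> (g (c i))))"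
        unfolding a_def using finite_I x
        by (subst S.finsum_rdistr) (auto simp: c_closed d_closed g_closed)
      also have "\<dots> = (\<Oplus>\<^bsub>R\<^esub>i\<in>I. E (x \<otimes>\<^bsub>A\<^esub> (d i \<otimes>\<^bsub>A\<^esub> \<iota> (g (c i)))))"
        using x by (intro abelian_group_hom.hom_finsum[OF E_hom]) (auto simp: c_closed d_closed g_closed)
      also have "\<dots> = (\<Oplus>\<^bsub>R\<^esub>i\<in>I. g (\<iota> (E (x \<otimes>\<^bsub>A\<^esub> d i)) \<otimes>\<^bsub>A\<^esub> c i))"
        using x left_hom_smult[OF g, unfolded ring_bimodule_simps]
        by (intro R.finsum_cong')
          (auto simp: c_closed d_closed g_closed E_closed E_right simp flip: S.m_assoc)
      also have "\<dots> = g (\<Oplus>\<^bsub>A\<^esub>i\<in>I. \<iota> (E (x \<otimes>\<^bsub>A\<^esub> d i)) \<otimes>\<^bsub>A\<^esub> c i)"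
        using x by (intro abelian_group_hom.hom_finsum[OF g_hom, symmetric])
          (auto simp: c_closed d_closed E_closed)
      finally show ?thesis by (simp add: left_basis x)
    qed
    then have "\<phi> a = g"
      using a left_hom_extensional[OF g]
      by (intro extensionalityI[of _ "carrier A"]) (auto simp: \<phi>_def ring_bimodule_simps)
    with a show "g \<in> \<phi> ` carrier A" by blast
  qed (auto intro: \<phi>_closed)
  moreover have "\<phi> \<in> left_hom A (ring_bimodule A id \<iota>) ?H"
    using \<phi>_closed
    by (auto simp: left_hom_def ring_bimodule_simps hom_bimodule_simps \<phi>_def E_add S.r_distr S.m_assoc
        intro!: restrict_ext)
  moreover have "\<phi> (a \<cdot>\<^bsub>ring_bimodule A id \<iota>\<^esub> r) = \<phi> a \<cdot>\<^bsub>?H\<^esub> r" if "a \<in> carrier A" "r \<in> carrier R" for a r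
    using that
    by (auto simp: ring_bimodule_simps hom_bimodule_simps \<phi>_def E_right simp flip: S.m_assoc
        intro!: restrict_ext)
  ultimately show "bimodule_iso A R (ring_bimodule A id \<iota>) ?H"
    unfolding bimodule_iso_def bij_betw_def ring_bimodule_simps(1) by blast
qed

end

section \<open>Centrally projective Frobenius extensions\<close>

text \<open>The difference of the first components equals the reversed difference of the second
  ones, so it lies in both subgroups. This takes the place of a projection onto \<open>H\<close>:
  equations in a direct sum are compared component by component.\<close>

lemma (in abelian_group) subgroup_sum_unique:
  assumes H: "subgroup H (add_monoid G)" and K: "subgroup K (add_monoid G)" and "H \<inter> K = {\<zero>}"
    and h: "h \<in> H" "h' \<in> H" and k: "k \<in> K" "k' \<in> K" and "h \<oplus> k = h' \<oplus> k'"
  shows "h = h'"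
proof -
  have carr: "h \<in> carrier G" "h' \<in> carrier G" "k \<in> carrier G" "k' \<in> carrier G"
    using subgroup.subset[OF H] subgroup.subset[OF K] h k by auto
  have "h \<ominus> h' = h \<oplus> k \<ominus> k \<ominus> h'"
    using carr by (simp add: minus_eq a_assoc r_neg)
  also have "\<dots> = k' \<ominus> k"
    unfolding assms(8) using carr
    by (simp add: minus_eq a_assoc a_comm[of "\<ominus> k" "\<ominus> h'"] a_lcomm[of k' "\<ominus> h'"] r_neg2)
  finally have eq: "h \<ominus> h' = k' \<ominus> k" .
  have "h \<ominus> h' \<in> H"
    using subgroup.m_closed[OF H h(1) subgroup.m_inv_closed[OF H h(2)]] by (simp add: minus_eq a_inv_def)
  moreover have "k' \<ominus> k \<in> K"
    using subgroup.m_closed[OF K k(2) subgroup.m_inv_closed[OF K k(1)]] by (simp add: minus_eq a_inv_def)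
  ultimately have "h \<ominus> h' = \<zero>"
    using eq assms(3) by auto
  moreover have "h = (h \<ominus> h') \<oplus> h'"
    using carr by (simp add: minus_eq a_assoc l_neg)
  ultimately show ?thesis
    using carr by simp
qed

lemma centrally_projective_frobenius_system:
  fixes R :: "('r, 'x) ring_scheme" and A :: "('a, 'y) ring_scheme"
  assumes "frobenius_extension R A \<iota>" "centrally_projective R A \<iota>"
  obtains n :: nat and E c d where "frobenius_system R A \<iota> E {..<n} c d"
    "\<And>i r. \<lbrakk>i < n; r \<in> carrier R\<rbrakk> \<Longrightarrow> c i \<otimes>\<^bsub>A\<^esub> \<iota> r = \<iota> r \<otimes>\<^bsub>A\<^esub> c i"
    "\<And>i r. \<lbrakk>i < n; r \<in> carrier R\<rbrakk> \<Longrightarrow> d i \<otimes>\<^bsub>A\<^esub> \<iota> r = \<iota> r \<otimes>\<^bsub>A\<^esub> d i"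
proof -
  interpret \<iota>: ring_hom_ring R A \<iota>
    using assms(1) by (simp add: frobenius_extension_def)
  let ?H = "hom_bimodule R (ring_bimodule A \<iota> id) (ring_bimodule R id id)"
  obtain \<phi> where \<phi>: "\<phi> \<in> left_hom A (ring_bimodule A id \<iota>) ?H"
    and \<phi>_bij: "bij_betw \<phi> (carrier A) (carrier ?H)"
    and \<phi>_rsmult: "\<And>a r. \<lbrakk>a \<in> carrier A; r \<in> carrier R\<rbrakk> \<Longrightarrow> \<phi> (a \<otimes>\<^bsub>A\<^esub> \<iota> r) = \<phi> a \<cdot>\<^bsub>?H\<^esub> r"
    using assms(1) unfolding frobenius_extension_def bimodule_iso_def
    by (auto simp: ring_bimodule_simps)
  \<comment> \<open>Linearity of \<open>\<phi>\<close> over A makes its value at 1 determine it: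
    \<phi>(a) = a E is the functional x \<mapsto> E(x a).\<close>
  define E where "E = \<phi> \<one>\<^bsub>A\<^esub>"
  have \<phi>_apply: "\<phi> a x = E (x \<otimes>\<^bsub>A\<^esub> a)" if a: "a \<in> carrier A" and x: "x \<in> carrier A" for a x
    using left_hom_smult[OF \<phi> a, of "\<one>\<^bsub>A\<^esub>"] a x
    by (simp add: ring_bimodule_simps hom_bimodule_simps E_def)
  \<comment> \<open>Nondegeneracy of the form (x, a) \<mapsto> E(x a). Identities in A are proved
    below by applying E(x -) to both sides.\<close>
  have \<phi>_eqI: "a = b" if "a \<in> carrier A" "b \<in> carrier A" "\<And>x. x \<in> carrier A \<Longrightarrow> E (x \<otimes>\<^bsub>A\<^esub> a) = E (x \<otimes>\<^bsub>A\<^esub> b)"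
    for a b
  proof (rule inj_onD[OF bij_betw_imp_inj_on[OF \<phi>_bij] _ that(1,2)])
    have "\<phi> a \<in> left_hom R (ring_bimodule A \<iota> id) (ring_bimodule R id id)"
      "\<phi> b \<in> left_hom R (ring_bimodule A \<iota> id) (ring_bimodule R id id)"
      using bij_betwE[OF \<phi>_bij] that by (auto simp: hom_bimodule_simps)
    then show "\<phi> a = \<phi> b"
      by (rule left_hom_eqI) (simp add: ring_bimodule_simps \<phi>_apply that)
  qed
  have E: "E \<in> left_hom R (ring_bimodule A \<iota> id) (ring_bimodule R id id)"
    using bij_betwE[OF \<phi>_bij] by (auto simp: E_def hom_bimodule_simps)
  have E_closed: "E a \<in> carrier R" if "a \<in> carrier A" for a
    using left_hom_closed[OF E] that by (simp add: ring_bimodule_simps)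
  have E_add: "E (a \<oplus>\<^bsub>A\<^esub> b) = E a \<oplus>\<^bsub>R\<^esub> E b" if "a \<in> carrier A" "b \<in> carrier A" for a b
    using left_hom_add[OF E] that by (simp add: ring_bimodule_simps)
  have E_left: "E (\<iota> r \<otimes>\<^bsub>A\<^esub> a) = r \<otimes>\<^bsub>R\<^esub> E a" if "r \<in> carrier R" "a \<in> carrier A" for r a
    using left_hom_smult[OF E] that by (simp add: ring_bimodule_simps)
  \<comment> \<open>Functionals in the dual are only left linear. Right linearity of
    \<open>E\<close> comes from that of \<open>\<phi>\<close>: the functionals \<phi>(\<iota> r) and
    \<phi>(1) r coincide.\<close>
  have E_right: "E (a \<otimes>\<^bsub>A\<^esub> \<iota> r) = E a \<otimes>\<^bsub>R\<^esub> r" if "r \<in> carrier R" "a \<in> carrier A" for r a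
    using \<phi>_rsmult[of "\<one>\<^bsub>A\<^esub>" r] \<phi>_apply[of "\<iota> r" a] that
    by (simp add: hom_bimodule_simps ring_bimodule_simps E_def)
  have E_hom: "abelian_group_hom A R E"
    by (rule abelian_group_hom_of_additive)
      (simp_all add: \<iota>.R.abelian_group_axioms \<iota>.S.abelian_group_axioms E_closed E_add)

  obtain n :: nat and H g where "bimodule_summand H R R (free_bimodule R {..<n})"
    and g: "g \<in> left_hom R (ring_bimodule A \<iota> \<iota>) ((free_bimodule R {..<n})\<lparr>carrier := H\<rparr>)"
    and g_bij: "bij_betw g (carrier A) H"
    and g_rsmult: "\<And>a r. \<lbrakk>a \<in> carrier A; r \<in> carrier R\<rbrakk> \<Longrightarrow> g (a \<otimes>\<^bsub>A\<^esub> \<iota> r) = g a \<cdot>\<^bsub>free_bimodule R {..<n}\<^esub> r"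
    using assms(2) unfolding centrally_projective_def bimodule_iso_def
    by (auto simp: ring_bimodule_simps free_bimodule_def)
  define L where "L = free_bimodule R {..<n}"
  obtain K where H: "subbimodule H R R L" and K: "subbimodule K R R L"
    and HK: "H \<inter> K = {\<zero>\<^bsub>L\<^esub>}" "H <+>\<^bsub>L\<^esub> K = carrier L"
    using \<open>bimodule_summand H R R _\<close> unfolding bimodule_summand_def L_def by blast
  interpret L: left_module R L
    unfolding L_def by (rule \<iota>.R.left_module_free_bimodule) simp
  interpret H: submodule H R L using H by (simp add: subbimodule_def)
  interpret K: submodule K R L using K by (simp add: subbimodule_def)
  have H_carrier: "v \<in> carrier L" if "v \<in> H" for v using H.subset that by auto
  have K_carrier: "v \<in> carrier L" if "v \<in> K" for v using K.subset that by auto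
  have unique: "h = h'" if "h \<in> H" "h' \<in> H" "k \<in> K" "k' \<in> K" "h \<oplus>\<^bsub>L\<^esub> k = h' \<oplus>\<^bsub>L\<^esub> k'" for h h' k k'
    using L.M.subgroup_sum_unique[OF H.subgroup_axioms K.subgroup_axioms HK(1) that] .
  have g_H: "g a \<in> H" if "a \<in> carrier A" for a
    using bij_betwE[OF g_bij] that by auto
  have g_add: "g (a \<oplus>\<^bsub>A\<^esub> b) = g a \<oplus>\<^bsub>L\<^esub> g b" if "a \<in> carrier A" "b \<in> carrier A" for a b
    using left_hom_add[OF g] that by (simp add: ring_bimodule_simps L_def)
  have g_smult: "g (\<iota> r \<otimes>\<^bsub>A\<^esub> a) = r \<odot>\<^bsub>L\<^esub> g a" if "r \<in> carrier R" "a \<in> carrier A" for r a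
    using left_hom_smult[OF g] that by (simp add: ring_bimodule_simps L_def)
  have g_eqI: "a = b" if "a \<in> carrier A" "b \<in> carrier A" "g a = g b" for a b
    using inj_onD[OF bij_betw_imp_inj_on[OF g_bij]] that by blast
  have g_hom: "abelian_group_hom A L g"
    by (rule abelian_group_hom_of_additive)
      (simp_all add: L.M.abelian_group_axioms \<iota>.S.abelian_group_axioms H_carrier g_H g_add)
  have g_apply: "g a i \<in> carrier R" if "a \<in> carrier A" "i < n" for a i
    using H_carrier[OF g_H[OF that(1)]] that(2) by (auto simp: L_def intro: free_bimodule_closed)

  let ?e = "unit_vector R {..<n}"
  have e_closed: "?e i \<in> carrier L" for i
    unfolding L_def by (simp add: \<iota>.R.unit_vector_closed)
  have "\<exists>h k. h \<in> H \<and> k \<in> K \<and> ?e i = h \<oplus>\<^bsub>L\<^esub> k" for i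
    using e_closed[of i] unfolding HK(2)[symmetric] set_add_def' by auto
  then obtain h k where h: "\<And>i. h i \<in> H" and k: "\<And>i. k i \<in> K"
    and hk: "\<And>i. ?e i = h i \<oplus>\<^bsub>L\<^esub> k i"
    by metis
  define c where "c i = inv_into (carrier A) g (h i)" for i
  have c: "c i \<in> carrier A" "g (c i) = h i" for i
    using h[of i] g_bij unfolding c_def bij_betw_def by (auto intro: inv_into_into f_inv_into_f)
  have c_central: "c i \<otimes>\<^bsub>A\<^esub> \<iota> r = \<iota> r \<otimes>\<^bsub>A\<^esub> c i" if r: "r \<in> carrier R" for i r
  proof (rule g_eqI)
    \<comment> \<open>\<open>H\<close> and \<open>K\<close> are stable under both actions, so the
      equality of e_i r and r e_i splits into one equality of components in \<open>H\<close> and one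
      in \<open>K\<close>.\<close>
    have "h i \<cdot>\<^bsub>L\<^esub> r \<oplus>\<^bsub>L\<^esub> k i \<cdot>\<^bsub>L\<^esub> r = ?e i \<cdot>\<^bsub>L\<^esub> r"
      unfolding hk L_def using h k r
      by (intro \<iota>.R.free_bimodule_rsmult_add[symmetric]) (auto simp flip: L_def intro: H_carrier K_carrier)
    also have "\<dots> = r \<odot>\<^bsub>L\<^esub> ?e i"
      unfolding L_def using r by (intro \<iota>.R.unit_vector_central[symmetric]) auto
    also have "\<dots> = r \<odot>\<^bsub>L\<^esub> h i \<oplus>\<^bsub>L\<^esub> r \<odot>\<^bsub>L\<^esub> k i"
      unfolding hk using h k r by (intro L.smult_r_distr H_carrier K_carrier)
    finally have "h i \<cdot>\<^bsub>L\<^esub> r = r \<odot>\<^bsub>L\<^esub> h i"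
      by (rule unique[rotated 4])
        (use H K h k r in \<open>auto simp: subbimodule_def intro: H.smult_closed K.smult_closed\<close>)
    then show "g (c i \<otimes>\<^bsub>A\<^esub> \<iota> r) = g (\<iota> r \<otimes>\<^bsub>A\<^esub> c i)"
      using r c by (simp add: g_rsmult g_smult L_def)
  qed (use c r in simp_all)
  have c_basis: "(\<Oplus>\<^bsub>A\<^esub>i\<in>{..<n}. \<iota> (g a i) \<otimes>\<^bsub>A\<^esub> c i) = a" if a: "a \<in> carrier A" for a
  proof (rule g_eqI)
    \<comment> \<open>The expansion of g(a) in unit vectors is split along \<open>H\<close> and
      \<open>K\<close>. As g(a) lies in \<open>H\<close>, its component in \<open>K\<close> is zero,
      so the vectors \<open>h i\<close> alone already expand it.\<close>
    have "(\<Oplus>\<^bsub>L\<^esub>i\<in>{..<n}. g a i \<odot>\<^bsub>L\<^esub> h i) \<oplus>\<^bsub>L\<^esub> (\<Oplus>\<^bsub>L\<^esub>i\<in>{..<n}. g a i \<odot>\<^bsub>L\<^esub> k i) =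
        (\<Oplus>\<^bsub>L\<^esub>i\<in>{..<n}. g a i \<odot>\<^bsub>L\<^esub> h i \<oplus>\<^bsub>L\<^esub> g a i \<odot>\<^bsub>L\<^esub> k i)"
      using a h k by (intro L.M.finsum_addf[symmetric]) (auto intro!: L.smult_closed g_apply intro: H_carrier K_carrier)
    also have "\<dots> = (\<Oplus>\<^bsub>L\<^esub>i\<in>{..<n}. g a i \<odot>\<^bsub>L\<^esub> ?e i)"
      using a h k by (intro L.M.finsum_cong')
        (auto simp: hk L.smult_r_distr H_carrier K_carrier g_apply L.smult_closed)
    also have "\<dots> = g a"
      unfolding L_def using g_H[OF a] by (intro \<iota>.R.unit_vector_expansion) (auto simp flip: L_def intro: H_carrier)
    also have "\<dots> = g a \<oplus>\<^bsub>L\<^esub> \<zero>\<^bsub>L\<^esub>"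
      using H_carrier[OF g_H[OF a]] by simp
    finally have "(\<Oplus>\<^bsub>L\<^esub>i\<in>{..<n}. g a i \<odot>\<^bsub>L\<^esub> h i) = g a"
    proof (rule unique[rotated 4])
      show "(\<Oplus>\<^bsub>L\<^esub>i\<in>{..<n}. g a i \<odot>\<^bsub>L\<^esub> h i) \<in> H"
        using a h by (intro finsum_in_subgroup[OF L.M.abelian_group_axioms H.subgroup_axioms])
          (auto intro: H.smult_closed g_apply)
      show "(\<Oplus>\<^bsub>L\<^esub>i\<in>{..<n}. g a i \<odot>\<^bsub>L\<^esub> k i) \<in> K"
        using a k by (intro finsum_in_subgroup[OF L.M.abelian_group_axioms K.subgroup_axioms])
          (auto intro: K.smult_closed g_apply)
    qed (use g_H[OF a] K.one_closed in simp_all)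
    moreover have "g (\<Oplus>\<^bsub>A\<^esub>i\<in>{..<n}. \<iota> (g a i) \<otimes>\<^bsub>A\<^esub> c i) = (\<Oplus>\<^bsub>L\<^esub>i\<in>{..<n}. g (\<iota> (g a i) \<otimes>\<^bsub>A\<^esub> c i))"
      using a c by (intro abelian_group_hom.hom_finsum[OF g_hom]) (auto simp: g_apply)
    moreover have "\<dots> = (\<Oplus>\<^bsub>L\<^esub>i\<in>{..<n}. g a i \<odot>\<^bsub>L\<^esub> h i)"
      using a c h by (intro L.M.finsum_cong') (auto simp: g_smult g_apply H_carrier L.smult_closed)
    ultimately show "g (\<Oplus>\<^bsub>A\<^esub>i\<in>{..<n}. \<iota> (g a i) \<otimes>\<^bsub>A\<^esub> c i) = g a"
      by simp
  qed (use a c in \<open>auto intro!: \<iota>.S.finsum_closed simp: g_apply\<close>)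

  \<comment> \<open>The i-th coordinate of \<open>g\<close> is a left linear functional on A, so the
    surjectivity of \<open>\<phi>\<close> represents it.\<close>
  have "\<exists>d. d \<in> carrier A \<and> (\<forall>a\<in>carrier A. E (a \<otimes>\<^bsub>A\<^esub> d) = g a i)" if i: "i < n" for i
  proof -
    have "(\<lambda>a\<in>carrier A. g a i) \<in> carrier ?H"
      using i by (auto simp: hom_bimodule_simps left_hom_def ring_bimodule_simps g_apply g_add g_smult
          L_def free_bimodule_simps(3,4))
    then have "(\<lambda>a\<in>carrier A. g a i) \<in> \<phi> ` carrier A"
      by (simp only: bij_betw_imp_surj_on[OF \<phi>_bij])
    then obtain d where d: "d \<in> carrier A" "\<phi> d = (\<lambda>a\<in>carrier A. g a i)"
      by (elim imageE) simp
    with \<phi>_apply[OF d(1)] show ?thesis by auto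
  qed
  then obtain d where d: "\<And>i. i < n \<Longrightarrow> d i \<in> carrier A"
    and E_d: "\<And>i a. \<lbrakk>i < n; a \<in> carrier A\<rbrakk> \<Longrightarrow> E (a \<otimes>\<^bsub>A\<^esub> d i) = g a i"
    by metis
  have d_central: "d i \<otimes>\<^bsub>A\<^esub> \<iota> r = \<iota> r \<otimes>\<^bsub>A\<^esub> d i" if i: "i < n" and r: "r \<in> carrier R" for i r
  proof (rule \<phi>_eqI)
    fix x assume x: "x \<in> carrier A"
    \<comment> \<open>After E(x -) is applied, commutation of \<open>d i\<close> with \<iota>(r)
      says that the i-th coordinate map is right linear over R.\<close>
    have "E (x \<otimes>\<^bsub>A\<^esub> (d i \<otimes>\<^bsub>A\<^esub> \<iota> r)) = g x i \<otimes>\<^bsub>R\<^esub> r"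
      using i r x d by (simp add: \<iota>.S.m_assoc[symmetric] E_right E_d)
    also have "\<dots> = E (x \<otimes>\<^bsub>A\<^esub> (\<iota> r \<otimes>\<^bsub>A\<^esub> d i))"
      using i r x d by (simp add: \<iota>.S.m_assoc[symmetric] E_d g_rsmult free_bimodule_simps(5))
    finally show "E (x \<otimes>\<^bsub>A\<^esub> (d i \<otimes>\<^bsub>A\<^esub> \<iota> r)) = E (x \<otimes>\<^bsub>A\<^esub> (\<iota> r \<otimes>\<^bsub>A\<^esub> d i))" .
  qed (use d i r in simp_all)
  have left_basis: "(\<Oplus>\<^bsub>A\<^esub>i\<in>{..<n}. \<iota> (E (a \<otimes>\<^bsub>A\<^esub> d i)) \<otimes>\<^bsub>A\<^esub> c i) = a" if a: "a \<in> carrier A" for a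
  proof -
    have "(\<Oplus>\<^bsub>A\<^esub>i\<in>{..<n}. \<iota> (E (a \<otimes>\<^bsub>A\<^esub> d i)) \<otimes>\<^bsub>A\<^esub> c i) = (\<Oplus>\<^bsub>A\<^esub>i\<in>{..<n}. \<iota> (g a i) \<otimes>\<^bsub>A\<^esub> c i)"
      using a c by (intro \<iota>.S.finsum_cong') (auto simp: E_d g_apply)
    with c_basis[OF a] show ?thesis by simp
  qed
  have right_basis: "(\<Oplus>\<^bsub>A\<^esub>i\<in>{..<n}. d i \<otimes>\<^bsub>A\<^esub> \<iota> (E (c i \<otimes>\<^bsub>A\<^esub> a))) = a" if a: "a \<in> carrier A" for a
  proof (rule \<phi>_eqI)
    fix x assume x: "x \<in> carrier A"
    \<comment> \<open>The right identity is the left one seen through the form: each summand E(x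
      d_i) E(c_i a) can be regrouped as E(\<iota>(E(x d_i)) c_i a), and \<open>left_basis\<close>
      expands \<open>x\<close>.\<close>
    have "E (x \<otimes>\<^bsub>A\<^esub> (\<Oplus>\<^bsub>A\<^esub>i\<in>{..<n}. d i \<otimes>\<^bsub>A\<^esub> \<iota> (E (c i \<otimes>\<^bsub>A\<^esub> a)))) =
        E (\<Oplus>\<^bsub>A\<^esub>i\<in>{..<n}. x \<otimes>\<^bsub>A\<^esub> (d i \<otimes>\<^bsub>A\<^esub> \<iota> (E (c i \<otimes>\<^bsub>A\<^esub> a))))"
      using x a c d by (subst \<iota>.S.finsum_rdistr) (auto simp: E_closed)
    also have "\<dots> = (\<Oplus>\<^bsub>R\<^esub>i\<in>{..<n}. E (x \<otimes>\<^bsub>A\<^esub> (d i \<otimes>\<^bsub>A\<^esub> \<iota> (E (c i \<otimes>\<^bsub>A\<^esub> a)))))"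
      using x a c d by (intro abelian_group_hom.hom_finsum[OF E_hom]) (auto simp: E_closed)
    also have "\<dots> = (\<Oplus>\<^bsub>R\<^esub>i\<in>{..<n}. E (\<iota> (E (x \<otimes>\<^bsub>A\<^esub> d i)) \<otimes>\<^bsub>A\<^esub> c i \<otimes>\<^bsub>A\<^esub> a))"
      using x a c d
      by (intro \<iota>.R.finsum_cong')
        (auto simp: E_closed E_left E_right \<iota>.S.m_assoc[of "\<iota> _" "c _" a] simp flip: \<iota>.S.m_assoc[of x "d _" "\<iota> _"])
    also have "\<dots> = E (\<Oplus>\<^bsub>A\<^esub>i\<in>{..<n}. \<iota> (E (x \<otimes>\<^bsub>A\<^esub> d i)) \<otimes>\<^bsub>A\<^esub> c i \<otimes>\<^bsub>A\<^esub> a)"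
      using x a c d by (intro abelian_group_hom.hom_finsum[OF E_hom, symmetric]) (auto simp: E_closed)
    also have "\<dots> = E ((\<Oplus>\<^bsub>A\<^esub>i\<in>{..<n}. \<iota> (E (x \<otimes>\<^bsub>A\<^esub> d i)) \<otimes>\<^bsub>A\<^esub> c i) \<otimes>\<^bsub>A\<^esub> a)"
      using x a c d by (subst \<iota>.S.finsum_ldistr) (auto simp: E_closed)
    finally show "E (x \<otimes>\<^bsub>A\<^esub> (\<Oplus>\<^bsub>A\<^esub>i\<in>{..<n}. d i \<otimes>\<^bsub>A\<^esub> \<iota> (E (c i \<otimes>\<^bsub>A\<^esub> a)))) = E (x \<otimes>\<^bsub>A\<^esub> a)"
      by (simp add: left_basis x)
  qed (use a c d in \<open>auto intro!: \<iota>.S.finsum_closed simp: E_closed\<close>)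
  have "frobenius_system R A \<iota> E {..<n} c d"
    by (intro frobenius_system.intro frobenius_system_axioms.intro \<iota>.ring_hom_ring_axioms)
      (simp_all add: c d E_closed E_add E_left E_right left_basis right_basis)
  with c_central d_central show thesis
    by (intro that)
qed

section \<open>Module structures on tensor products\<close>

lemma tensor_smult: "a \<odot>\<^bsub>tensor R M N\<^esub> u = tensor_map R M N (\<lambda>m. a \<odot>\<^bsub>M\<^esub> m) (\<lambda>n. n) u"
  by (simp add: tensor_def)

lemma tensor_rsmult: "u \<cdot>\<^bsub>tensor R M N\<^esub> s = tensor_map R M N (\<lambda>m. m) (\<lambda>n. n \<cdot>\<^bsub>N\<^esub> s) u"
  by (simp add: tensor_def)

lemma abelian_group_hom_ident: "abelian_group G \<Longrightarrow> abelian_group_hom G G (\<lambda>x. x)"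
  by (rule abelian_group_hom_of_additive) simp_all

context tensor_factors
begin

section \<open>Left scalars on a tensor product\<close>

context
  fixes A :: "('a, 'q) ring_scheme"
  assumes M_left: "left_module A M"
    and M_bimodule: "\<And>a m r. \<lbrakk>a \<in> carrier A; m \<in> carrier M; r \<in> carrier R\<rbrakk> \<Longrightarrow>
      a \<odot>\<^bsub>M\<^esub> (m \<cdot>\<^bsub>M\<^esub> r) = (a \<odot>\<^bsub>M\<^esub> m) \<cdot>\<^bsub>M\<^esub> r"
begin

interpretation A: left_module A M by (rule M_left)

lemma tensor_smult_hom: "a \<in> carrier A \<Longrightarrow> abelian_group_hom P P (\<lambda>u. a \<odot>\<^bsub>P\<^esub> u)"
  unfolding tensor_smult
  by (rule tensor_map_hom[OF A.smult_hom abelian_group_hom_ident[OF N.abelian_group_axioms]])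
    (simp_all add: M_bimodule)

lemma tensor_smult_pure:
  "\<lbrakk>a \<in> carrier A; m \<in> carrier M; n \<in> carrier N\<rbrakk> \<Longrightarrow> a \<odot>\<^bsub>P\<^esub> (m \<odot>\<odot> n) = (a \<odot>\<^bsub>M\<^esub> m) \<odot>\<odot> n"
  unfolding tensor_smult
  by (rule tensor_map_pure[OF A.smult_hom abelian_group_hom_ident[OF N.abelian_group_axioms]])
    (simp_all add: M_bimodule)

text \<open>For fixed scalars, both sides of each remaining axiom are additive in the tensor, so the
  axioms of M on pure tensors suffice.\<close>

lemma left_module_tensor: "left_module A P"
proof (intro left_module.intro left_module_axioms.intro A.R.ring_axioms P.abelian_group_axioms)
  fix a u assume a: "a \<in> carrier A" and u: "u \<in> carrier P"
  interpret a: abelian_group_hom P P "\<lambda>u. a \<odot>\<^bsub>P\<^esub> u" using a by (rule tensor_smult_hom)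
  show "a \<odot>\<^bsub>P\<^esub> u \<in> carrier P" using u by simp
  show "a \<odot>\<^bsub>P\<^esub> (u \<oplus>\<^bsub>P\<^esub> v) = a \<odot>\<^bsub>P\<^esub> u \<oplus>\<^bsub>P\<^esub> a \<odot>\<^bsub>P\<^esub> v" if "v \<in> carrier P" for v
    using u that by simp
  fix b assume b: "b \<in> carrier A"
  interpret b: abelian_group_hom P P "\<lambda>u. b \<odot>\<^bsub>P\<^esub> u" using b by (rule tensor_smult_hom)
  have "abelian_group_hom P P (\<lambda>u. a \<odot>\<^bsub>P\<^esub> u \<oplus>\<^bsub>P\<^esub> b \<odot>\<^bsub>P\<^esub> u)"
    by (rule abelian_group_hom_of_additive) (simp_all add: P.abelian_group_axioms P.a_ac)
  from tensor_hom_eqI[OF tensor_smult_hom this u]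
  show "(a \<oplus>\<^bsub>A\<^esub> b) \<odot>\<^bsub>P\<^esub> u = a \<odot>\<^bsub>P\<^esub> u \<oplus>\<^bsub>P\<^esub> b \<odot>\<^bsub>P\<^esub> u"
    using a b by (simp add: tensor_smult_pure A.smult_l_distr A.smult_closed pure_add_left)
  have "abelian_group_hom P P (\<lambda>u. a \<odot>\<^bsub>P\<^esub> (b \<odot>\<^bsub>P\<^esub> u))"
    by (rule abelian_group_hom_compose[OF b.is_abelian_group_hom a.is_abelian_group_hom])
  from tensor_hom_eqI[OF tensor_smult_hom this u]
  show "(a \<otimes>\<^bsub>A\<^esub> b) \<odot>\<^bsub>P\<^esub> u = a \<odot>\<^bsub>P\<^esub> (b \<odot>\<^bsub>P\<^esub> u)"
    using a b by (simp add: tensor_smult_pure A.smult_assoc1 A.smult_closed)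
next
  fix u assume u: "u \<in> carrier P"
  from tensor_hom_eqI[OF tensor_smult_hom abelian_group_hom_ident[OF P.abelian_group_axioms] u]
  show "\<one>\<^bsub>A\<^esub> \<odot>\<^bsub>P\<^esub> u = u"
    by (simp add: tensor_smult_pure A.smult_one)
qed

end

section \<open>Right scalars on a tensor product\<close>

context
  fixes s
  assumes N_right: "abelian_group_hom N N (\<lambda>n. n \<cdot>\<^bsub>N\<^esub> s)"
    and N_bimodule: "\<And>r n. \<lbrakk>r \<in> carrier R; n \<in> carrier N\<rbrakk> \<Longrightarrow> (r \<odot>\<^bsub>N\<^esub> n) \<cdot>\<^bsub>N\<^esub> s = r \<odot>\<^bsub>N\<^esub> (n \<cdot>\<^bsub>N\<^esub> s)"
begin

lemma tensor_rsmult_hom: "abelian_group_hom P P (\<lambda>u. u \<cdot>\<^bsub>P\<^esub> s)"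
  unfolding tensor_rsmult
  by (rule tensor_map_hom[OF abelian_group_hom_ident[OF M.abelian_group_axioms] N_right])
    (simp_all add: N_bimodule)

lemma tensor_rsmult_pure:
  "\<lbrakk>m \<in> carrier M; n \<in> carrier N\<rbrakk> \<Longrightarrow> (m \<odot>\<odot> n) \<cdot>\<^bsub>P\<^esub> s = m \<odot>\<odot> (n \<cdot>\<^bsub>N\<^esub> s)"
  unfolding tensor_rsmult
  by (rule tensor_map_pure[OF abelian_group_hom_ident[OF M.abelian_group_axioms] N_right])
    (simp_all add: N_bimodule)

end

end


section \<open>Frobenius systems of endomorphism rings\<close>

lemma end_bimodule_simps:
  "carrier (end_bimodule M) = carrier M"
  "\<zero>\<^bsub>end_bimodule M\<^esub> = \<zero>\<^bsub>M\<^esub>"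
  "x \<oplus>\<^bsub>end_bimodule M\<^esub> y = x \<oplus>\<^bsub>M\<^esub> y"
  "r \<odot>\<^bsub>end_bimodule M\<^esub> x = r \<odot>\<^bsub>M\<^esub> x"
  "x \<cdot>\<^bsub>end_bimodule M\<^esub> f = f x"
  by (simp_all add: end_bimodule_def)

lemma restrict_left_scalars_simps:
  "carrier (restrict_left_scalars f M) = carrier M"
  "x \<oplus>\<^bsub>restrict_left_scalars f M\<^esub> y = x \<oplus>\<^bsub>M\<^esub> y"
  "r \<odot>\<^bsub>restrict_left_scalars f M\<^esub> x = f r \<odot>\<^bsub>M\<^esub> x"
  "x \<cdot>\<^bsub>restrict_left_scalars f M\<^esub> s = x \<cdot>\<^bsub>M\<^esub> s"
  by (simp_all add: restrict_left_scalars_def)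

lemma (in left_module) left_module_end_bimodule: "left_module R (end_bimodule M)"
  by (intro left_module.intro left_module_axioms.intro R.ring_axioms abelian_groupI)
    (auto simp: end_bimodule_simps smult_closed smult_l_distr smult_r_distr smult_assoc1 smult_one
      M.add.m_ac intro: M.add.l_inv_ex[simplified])

locale central_frobenius_system = frobenius_system R A \<iota> E I c d + T: left_module R T
  for R :: "('r, 'x) ring_scheme" and A :: "('a, 'y) ring_scheme" and \<iota> E
    and I :: "'i set" and c d and T :: "('r, 't, 'z) module_scheme" +
  assumes c_central: "\<lbrakk>i \<in> I; r \<in> carrier R\<rbrakk> \<Longrightarrow> c i \<otimes>\<^bsub>A\<^esub> \<iota> r = \<iota> r \<otimes>\<^bsub>A\<^esub> c i"
    and d_central: "\<lbrakk>i \<in> I; r \<in> carrier R\<rbrakk> \<Longrightarrow> d i \<otimes>\<^bsub>A\<^esub> \<iota> r = \<iota> r \<otimes>\<^bsub>A\<^esub> d i"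
begin

section \<open>The left A-module A \<otimes> T\<close>

abbreviation "M \<equiv> ring_bimodule A id \<iota>"
abbreviation "N \<equiv> end_bimodule T"
abbreviation "X \<equiv> tensor R M N"

lemma M_left: "left_module A M"
  by (rule ring_hom_ring.left_module_ring_bimodule) (simp add: ring_hom_ringI S.ring_axioms)

sublocale X: tensor_factors R M N
proof (intro tensor_factors.intro tensor_factors_axioms.intro)
  show "abelian_group M" by (rule left_module.axioms[OF M_left])
  show "abelian_group N" by (rule left_module.axioms[OF T.left_module_end_bimodule])
qed (simp_all add: ring_bimodule_simps end_bimodule_simps T.smult_closed)

abbreviation pure_AT (infixl \<open>\<otimes>\<^sub>T\<close> 75) where "a \<otimes>\<^sub>T t \<equiv> pure_tensor R M N a t"

lemma pure_AT_closed: "\<lbrakk>a \<in> carrier A; t \<in> carrier T\<rbrakk> \<Longrightarrow> a \<otimes>\<^sub>T t \<in> carrier X"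
  using X.pure_closed by (simp add: ring_bimodule_simps end_bimodule_simps)

lemma pure_AT_balanced:
  "\<lbrakk>a \<in> carrier A; r \<in> carrier R; t \<in> carrier T\<rbrakk> \<Longrightarrow> (a \<otimes>\<^bsub>A\<^esub> \<iota> r) \<otimes>\<^sub>T t = a \<otimes>\<^sub>T (r \<odot>\<^bsub>T\<^esub> t)"
  using X.pure_balanced by (simp add: ring_bimodule_simps end_bimodule_simps)

lemma pure_AT_hom_left: "t \<in> carrier T \<Longrightarrow> abelian_group_hom A X (\<lambda>a. a \<otimes>\<^sub>T t)"
  by (rule abelian_group_hom_of_additive)
    (use X.pure_add_left in \<open>simp_all add: S.abelian_group_axioms X.P.abelian_group_axioms pure_AT_closed
      ring_bimodule_simps end_bimodule_simps\<close>)

lemma pure_AT_hom_right: "a \<in> carrier A \<Longrightarrow> abelian_group_hom T X (\<lambda>t. a \<otimes>\<^sub>T t)"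
  by (rule abelian_group_hom_of_additive)
    (use X.pure_add_right in \<open>simp_all add: T.M.abelian_group_axioms X.P.abelian_group_axioms pure_AT_closed
      ring_bimodule_simps end_bimodule_simps\<close>)

lemma X_hom_eqI:
  assumes "abelian_group_hom X G h" "abelian_group_hom X G k" "u \<in> carrier X"
    and "\<And>a t. \<lbrakk>a \<in> carrier A; t \<in> carrier T\<rbrakk> \<Longrightarrow> h (a \<otimes>\<^sub>T t) = k (a \<otimes>\<^sub>T t)"
  shows "h u = k u"
  using assms by (intro X.tensor_hom_eqI[of G h k u]) (auto simp: ring_bimodule_simps end_bimodule_simps)

lemma M_bimodule:
  "\<lbrakk>a \<in> carrier A; m \<in> carrier M; r \<in> carrier R\<rbrakk> \<Longrightarrow> a \<odot>\<^bsub>M\<^esub> (m \<cdot>\<^bsub>M\<^esub> r) = (a \<odot>\<^bsub>M\<^esub> m) \<cdot>\<^bsub>M\<^esub> r"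
  by (simp add: ring_bimodule_simps S.m_assoc)

sublocale XL: left_module A X
  using M_left M_bimodule by (rule X.left_module_tensor)

lemma smult_pure: "\<lbrakk>a \<in> carrier A; b \<in> carrier A; t \<in> carrier T\<rbrakk> \<Longrightarrow> a \<odot>\<^bsub>X\<^esub> (b \<otimes>\<^sub>T t) = (a \<otimes>\<^bsub>A\<^esub> b) \<otimes>\<^sub>T t"
  using X.tensor_smult_pure[OF M_left M_bimodule, of a b t]
  by (simp add: ring_bimodule_simps end_bimodule_simps)

lemma pure_eq_smult: "\<lbrakk>a \<in> carrier A; t \<in> carrier T\<rbrakk> \<Longrightarrow> a \<otimes>\<^sub>T t = a \<odot>\<^bsub>X\<^esub> (\<one>\<^bsub>A\<^esub> \<otimes>\<^sub>T t)"
  by (simp add: smult_pure)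

section \<open>The homomorphism from S to B\<close>

abbreviation "S \<equiv> end_ring R T"
abbreviation "B \<equiv> end_ring A X"

text \<open>Since a \<otimes> t = a (1 \<otimes> t), the tensors 1 \<otimes> t generate A \<otimes>
  T over A. Identities in B are tested on them from here on.\<close>

lemma B_eqI:
  assumes \<beta>: "\<beta> \<in> carrier B" and \<gamma>: "\<gamma> \<in> carrier B"
    and eq: "\<And>t. t \<in> carrier T \<Longrightarrow> \<beta> (\<one>\<^bsub>A\<^esub> \<otimes>\<^sub>T t) = \<gamma> (\<one>\<^bsub>A\<^esub> \<otimes>\<^sub>T t)"
  shows "\<beta> = \<gamma>"
proof (rule XL.end_eqI[OF \<beta> \<gamma>])
  fix u assume "u \<in> carrier X"
  with XL.end_hom[OF \<beta>] XL.end_hom[OF \<gamma>] show "\<beta> u = \<gamma> u"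
  proof (rule X_hom_eqI)
    fix a t assume "a \<in> carrier A" "t \<in> carrier T"
    then show "\<beta> (a \<otimes>\<^sub>T t) = \<gamma> (a \<otimes>\<^sub>T t)"
      using XL.end_smult[OF \<beta>, of a "\<one>\<^bsub>A\<^esub> \<otimes>\<^sub>T t"] XL.end_smult[OF \<gamma>, of a "\<one>\<^bsub>A\<^esub> \<otimes>\<^sub>T t"] eq
      by (simp add: pure_eq_smult[of a] pure_AT_closed)
  qed
qed

definition "\<rho> s = restrict (tensor_map R M N (\<lambda>a. a) s) (carrier X)"

context
  fixes s
  assumes s: "s \<in> carrier S"
begin

lemma s_hom: "abelian_group_hom N N s"
  using T.end_closed[OF s] T.end_add[OF s]
  by (intro abelian_group_hom_of_additive) (simp_all add: end_bimodule_simps X.N.abelian_group_axioms)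

lemma \<rho>_pure: "\<lbrakk>a \<in> carrier A; t \<in> carrier T\<rbrakk> \<Longrightarrow> \<rho> s (a \<otimes>\<^sub>T t) = a \<otimes>\<^sub>T s t"
  using X.tensor_map_pure[OF abelian_group_hom_ident[OF X.M.abelian_group_axioms] s_hom, of a t]
  by (simp add: \<rho>_def pure_AT_closed ring_bimodule_simps end_bimodule_simps T.end_smult[OF s])

lemma \<rho>_hom: "abelian_group_hom X X (\<rho> s)"
  unfolding \<rho>_def
  using X.tensor_map_hom[OF abelian_group_hom_ident[OF X.M.abelian_group_axioms] s_hom]
  by (intro abelian_group_hom_restrict) (simp add: end_bimodule_simps T.end_smult[OF s])

lemma \<rho>_closed: "\<rho> s \<in> carrier B"
proof -
  interpret \<rho>: abelian_group_hom X X "\<rho> s" by (rule \<rho>_hom)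
  have "\<rho> s (a \<odot>\<^bsub>X\<^esub> u) = a \<odot>\<^bsub>X\<^esub> \<rho> s u" if a: "a \<in> carrier A" and u: "u \<in> carrier X" for a u
    using abelian_group_hom_compose[OF XL.smult_hom[OF a] \<rho>_hom]
      abelian_group_hom_compose[OF \<rho>_hom XL.smult_hom[OF a]] u
    by (rule X_hom_eqI) (simp_all add: a smult_pure \<rho>_pure T.end_closed[OF s])
  then have "restrict (\<rho> s) (carrier X) \<in> carrier B"
    by (intro XL.restrict_end \<rho>_hom)
  then show ?thesis by (simp add: \<rho>_def)
qed

end

lemma \<rho>_ring_hom: "ring_hom_ring S B \<rho>"
proof (rule ring_hom_ringI[OF T.ring_end_ring XL.ring_end_ring])
  fix s s' assume s: "s \<in> carrier S" "s' \<in> carrier S"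
  show "\<rho> (s \<otimes>\<^bsub>S\<^esub> s') = \<rho> s \<otimes>\<^bsub>B\<^esub> \<rho> s'"
    using s by (intro B_eqI)
      (simp_all add: \<rho>_closed \<rho>_pure pure_AT_closed XL.end_ring_apply T.end_ring_apply T.end_closed)
  show "\<rho> (s \<oplus>\<^bsub>S\<^esub> s') = \<rho> s \<oplus>\<^bsub>B\<^esub> \<rho> s'"
    using s abelian_group_hom.hom_add[OF pure_AT_hom_right[OF S.one_closed]] by (intro B_eqI)
      (simp_all add: \<rho>_closed \<rho>_pure pure_AT_closed XL.end_ring_apply T.end_ring_apply T.end_closed)
next
  show "\<rho> \<one>\<^bsub>S\<^esub> = \<one>\<^bsub>B\<^esub>"
    by (intro B_eqI) (simp_all add: \<rho>_closed \<rho>_pure pure_AT_closed XL.end_ring_apply T.end_ring_apply)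
qed (rule \<rho>_closed)

section \<open>Right multiplications by elements centralizing R\<close>

definition "rmult b = restrict (tensor_map R M N (\<lambda>a. a \<otimes>\<^bsub>A\<^esub> b) (\<lambda>t. t)) (carrier X)"

context
  fixes b
  assumes b: "b \<in> carrier A" and b_central: "\<And>r. r \<in> carrier R \<Longrightarrow> b \<otimes>\<^bsub>A\<^esub> \<iota> r = \<iota> r \<otimes>\<^bsub>A\<^esub> b"
begin

lemma b_hom: "abelian_group_hom M M (\<lambda>a. a \<otimes>\<^bsub>A\<^esub> b)"
  using b by (intro abelian_group_hom_of_additive)
    (simp_all add: ring_bimodule_simps X.M.abelian_group_axioms S.l_distr)

text \<open>This makes right multiplication by \<open>b\<close> compatible with balancing: in m
  \<iota>(r) b the scalar has to move past \<open>b\<close> to stay next to the tensor sign.\<close>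

lemma b_rsmult: "\<lbrakk>m \<in> carrier M; r \<in> carrier R\<rbrakk> \<Longrightarrow> (m \<cdot>\<^bsub>M\<^esub> r) \<otimes>\<^bsub>A\<^esub> b = (m \<otimes>\<^bsub>A\<^esub> b) \<cdot>\<^bsub>M\<^esub> r"
  using b b_central by (simp add: ring_bimodule_simps S.m_assoc)

lemma rmult_pure: "\<lbrakk>a \<in> carrier A; t \<in> carrier T\<rbrakk> \<Longrightarrow> rmult b (a \<otimes>\<^sub>T t) = (a \<otimes>\<^bsub>A\<^esub> b) \<otimes>\<^sub>T t"
  using X.tensor_map_pure[OF b_hom abelian_group_hom_ident[OF X.N.abelian_group_axioms] b_rsmult, of a t]
  by (simp add: rmult_def pure_AT_closed ring_bimodule_simps end_bimodule_simps)

lemma rmult_hom: "abelian_group_hom X X (rmult b)"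
  unfolding rmult_def
  using X.tensor_map_hom[OF b_hom abelian_group_hom_ident[OF X.N.abelian_group_axioms] b_rsmult]
  by (intro abelian_group_hom_restrict) simp

lemma rmult_closed: "rmult b \<in> carrier B"
proof -
  have "rmult b (a \<odot>\<^bsub>X\<^esub> u) = a \<odot>\<^bsub>X\<^esub> rmult b u" if a: "a \<in> carrier A" and u: "u \<in> carrier X" for a u
    using abelian_group_hom_compose[OF XL.smult_hom[OF a] rmult_hom]
      abelian_group_hom_compose[OF rmult_hom XL.smult_hom[OF a]] u
    by (rule X_hom_eqI) (simp_all add: a b smult_pure rmult_pure S.m_assoc)
  then have "restrict (rmult b) (carrier X) \<in> carrier B"
    by (intro XL.restrict_end rmult_hom)
  then show ?thesis by (simp add: rmult_def)
qed

end

lemmas rmult_c = rmult_pure[OF c_closed c_central] rmult_hom[OF c_closed c_central] rmult_closed[OF c_closed c_central]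
lemmas rmult_d = rmult_pure[OF d_closed d_central] rmult_hom[OF d_closed d_central] rmult_closed[OF d_closed d_central]

text \<open>The map \<open>E \<otimes> T\<close>, with \<open>R \<otimes>\<^sub>R T\<close> identified with \<open>T\<close>.\<close>

definition "\<epsilon> = (SOME h. abelian_group_hom X T h \<and>
  (\<forall>a\<in>carrier A. \<forall>t\<in>carrier T. h (a \<otimes>\<^sub>T t) = E a \<odot>\<^bsub>T\<^esub> t))"

text \<open>Right linearity of \<open>E\<close> makes (a, t) \<mapsto> E(a) t balanced, because E(a
  \<iota>(r)) t = E(a) (r t). The universal property then provides the map that the choice operator
  names.\<close>

lemma \<epsilon>: "abelian_group_hom X T \<epsilon> \<and> (\<forall>a\<in>carrier A. \<forall>t\<in>carrier T. \<epsilon> (a \<otimes>\<^sub>T t) = E a \<odot>\<^bsub>T\<^esub> t)"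
proof -
  obtain h where "abelian_group_hom X T h"
    "\<And>m n. \<lbrakk>m \<in> carrier M; n \<in> carrier N\<rbrakk> \<Longrightarrow> h (m \<otimes>\<^sub>T n) = E m \<odot>\<^bsub>T\<^esub> n"
    by (rule X.tensor_universal[OF T.M.abelian_group_axioms, of "\<lambda>a t. E a \<odot>\<^bsub>T\<^esub> t"])
      (simp_all add: ring_bimodule_simps end_bimodule_simps E_closed E_add E_right
        T.smult_closed T.smult_l_distr T.smult_r_distr T.smult_assoc1)
  then have "\<exists>h. abelian_group_hom X T h \<and> (\<forall>a\<in>carrier A. \<forall>t\<in>carrier T. h (a \<otimes>\<^sub>T t) = E a \<odot>\<^bsub>T\<^esub> t)"
    by (auto simp: ring_bimodule_simps end_bimodule_simps)
  then show ?thesis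
    unfolding \<epsilon>_def by (rule someI_ex)
qed

lemma \<epsilon>_hom: "abelian_group_hom X T \<epsilon>"
  using \<epsilon> by blast

lemma \<epsilon>_pure: "\<lbrakk>a \<in> carrier A; t \<in> carrier T\<rbrakk> \<Longrightarrow> \<epsilon> (a \<otimes>\<^sub>T t) = E a \<odot>\<^bsub>T\<^esub> t"
  using \<epsilon> by blast

lemma \<epsilon>_closed: "u \<in> carrier X \<Longrightarrow> \<epsilon> u \<in> carrier T"
  using abelian_group_hom.hom_closed[OF \<epsilon>_hom] .

text \<open>Here the left linearity of \<open>E\<close> enters. It is the reason why the values of
  \<open>E\<^sub>B\<close> are R-linear.\<close>

lemma \<epsilon>_smult:
  assumes r: "r \<in> carrier R" and u: "u \<in> carrier X"
  shows "\<epsilon> (\<iota> r \<odot>\<^bsub>X\<^esub> u) = r \<odot>\<^bsub>T\<^esub> \<epsilon> u"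
  using abelian_group_hom_compose[OF XL.smult_hom[OF hom_closed[OF r]] \<epsilon>_hom]
    abelian_group_hom_compose[OF \<epsilon>_hom T.smult_hom[OF r]] u
  by (rule X_hom_eqI) (simp_all add: r smult_pure \<epsilon>_pure E_left E_closed T.smult_assoc1)

text \<open>Endomorphisms of T commute with the scalars E(a). This naturality of
  \<open>\<epsilon>\<close> becomes the right S-linearity of \<open>E\<^sub>B\<close>.\<close>

lemma \<epsilon>_\<rho>:
  assumes s: "s \<in> carrier S" and u: "u \<in> carrier X"
  shows "\<epsilon> (\<rho> s u) = s (\<epsilon> u)"
  using abelian_group_hom_compose[OF \<rho>_hom[OF s] \<epsilon>_hom]
    abelian_group_hom_compose[OF \<epsilon>_hom T.end_hom[OF s]] u
  by (rule X_hom_eqI) (simp_all add: s \<rho>_pure \<epsilon>_pure E_closed T.end_smult T.end_closed)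

text \<open>Both sides are additive in \<open>u\<close>. On a \<otimes> t the scalar E(a d_i)
  crosses the tensor sign to the right of c_i, passes c_i by centrality, and
  \<open>left_basis\<close> sums up the left factors.\<close>

lemma left_expansion:
  assumes u: "u \<in> carrier X"
  shows "(\<Oplus>\<^bsub>X\<^esub>i\<in>I. c i \<otimes>\<^sub>T \<epsilon> (rmult (d i) u)) = u"
proof (rule X_hom_eqI[of X _ "\<lambda>u. u", OF _ _ u])
  show "abelian_group_hom X X (\<lambda>u. \<Oplus>\<^bsub>X\<^esub>i\<in>I. c i \<otimes>\<^sub>T \<epsilon> (rmult (d i) u))"
    by (intro abelian_group_hom_finsum X.P.abelian_group_axioms
        abelian_group_hom_compose[OF abelian_group_hom_compose[OF rmult_d(2) \<epsilon>_hom] pure_AT_hom_right] c_closed)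
  show "abelian_group_hom X X (\<lambda>u. u)"
    by (rule abelian_group_hom_ident[OF X.P.abelian_group_axioms])
  fix a t assume a: "a \<in> carrier A" and t: "t \<in> carrier T"
  have "c i \<otimes>\<^sub>T \<epsilon> (rmult (d i) (a \<otimes>\<^sub>T t)) = (\<iota> (E (a \<otimes>\<^bsub>A\<^esub> d i)) \<otimes>\<^bsub>A\<^esub> c i) \<otimes>\<^sub>T t" if i: "i \<in> I" for i
    using i a t
    by (simp add: rmult_d(1) \<epsilon>_pure c_closed d_closed E_closed pure_AT_balanced flip: c_central)
  then have "(\<Oplus>\<^bsub>X\<^esub>i\<in>I. c i \<otimes>\<^sub>T \<epsilon> (rmult (d i) (a \<otimes>\<^sub>T t))) =
      (\<Oplus>\<^bsub>X\<^esub>i\<in>I. (\<iota> (E (a \<otimes>\<^bsub>A\<^esub> d i)) \<otimes>\<^bsub>A\<^esub> c i) \<otimes>\<^sub>T t)"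
    using a t by (intro X.P.finsum_cong') (auto simp: pure_AT_closed c_closed d_closed E_closed)
  also have "\<dots> = (\<Oplus>\<^bsub>A\<^esub>i\<in>I. \<iota> (E (a \<otimes>\<^bsub>A\<^esub> d i)) \<otimes>\<^bsub>A\<^esub> c i) \<otimes>\<^sub>T t"
    using a by (intro abelian_group_hom.hom_finsum[OF pure_AT_hom_left[OF t], symmetric])
      (auto simp: c_closed d_closed E_closed)
  finally show "(\<Oplus>\<^bsub>X\<^esub>i\<in>I. c i \<otimes>\<^sub>T \<epsilon> (rmult (d i) (a \<otimes>\<^sub>T t))) = a \<otimes>\<^sub>T t"
    by (simp add: left_basis a)
qed

text \<open>On a \<otimes> t the scalar E(c_i a) crosses the tensor sign and lands to the right of
  d_i, where \<open>right_basis\<close> has it.\<close>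

lemma right_expansion:
  assumes u: "u \<in> carrier X"
  shows "(\<Oplus>\<^bsub>X\<^esub>i\<in>I. d i \<otimes>\<^sub>T \<epsilon> (c i \<odot>\<^bsub>X\<^esub> u)) = u"
proof (rule X_hom_eqI[of X _ "\<lambda>u. u", OF _ _ u])
  show "abelian_group_hom X X (\<lambda>u. \<Oplus>\<^bsub>X\<^esub>i\<in>I. d i \<otimes>\<^sub>T \<epsilon> (c i \<odot>\<^bsub>X\<^esub> u))"
    by (intro abelian_group_hom_finsum X.P.abelian_group_axioms
        abelian_group_hom_compose[OF abelian_group_hom_compose[OF XL.smult_hom \<epsilon>_hom] pure_AT_hom_right]
        c_closed d_closed)
  show "abelian_group_hom X X (\<lambda>u. u)"
    by (rule abelian_group_hom_ident[OF X.P.abelian_group_axioms])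
  fix a t assume a: "a \<in> carrier A" and t: "t \<in> carrier T"
  have "d i \<otimes>\<^sub>T \<epsilon> (c i \<odot>\<^bsub>X\<^esub> (a \<otimes>\<^sub>T t)) = (d i \<otimes>\<^bsub>A\<^esub> \<iota> (E (c i \<otimes>\<^bsub>A\<^esub> a))) \<otimes>\<^sub>T t" if i: "i \<in> I" for i
    using i a t
    by (simp add: smult_pure \<epsilon>_pure c_closed d_closed E_closed pure_AT_balanced)
  then have "(\<Oplus>\<^bsub>X\<^esub>i\<in>I. d i \<otimes>\<^sub>T \<epsilon> (c i \<odot>\<^bsub>X\<^esub> (a \<otimes>\<^sub>T t))) =
      (\<Oplus>\<^bsub>X\<^esub>i\<in>I. (d i \<otimes>\<^bsub>A\<^esub> \<iota> (E (c i \<otimes>\<^bsub>A\<^esub> a))) \<otimes>\<^sub>T t)"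
    using a t by (intro X.P.finsum_cong') (auto simp: pure_AT_closed c_closed d_closed E_closed)
  also have "\<dots> = (\<Oplus>\<^bsub>A\<^esub>i\<in>I. d i \<otimes>\<^bsub>A\<^esub> \<iota> (E (c i \<otimes>\<^bsub>A\<^esub> a))) \<otimes>\<^sub>T t"
    using a by (intro abelian_group_hom.hom_finsum[OF pure_AT_hom_left[OF t], symmetric])
      (auto simp: c_closed d_closed E_closed)
  finally show "(\<Oplus>\<^bsub>X\<^esub>i\<in>I. d i \<otimes>\<^sub>T \<epsilon> (c i \<odot>\<^bsub>X\<^esub> (a \<otimes>\<^sub>T t))) = a \<otimes>\<^sub>T t"
    by (simp add: right_basis a)
qed

section \<open>The Frobenius system of B over S\<close>

definition "E\<^sub>B \<beta> = (\<lambda>t\<in>carrier T. \<epsilon> (\<beta> (\<one>\<^bsub>A\<^esub> \<otimes>\<^sub>T t)))"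

lemma E\<^sub>B_apply: "t \<in> carrier T \<Longrightarrow> E\<^sub>B \<beta> t = \<epsilon> (\<beta> (\<one>\<^bsub>A\<^esub> \<otimes>\<^sub>T t))"
  by (simp add: E\<^sub>B_def)

lemma E\<^sub>B_closed:
  assumes \<beta>: "\<beta> \<in> carrier B"
  shows "E\<^sub>B \<beta> \<in> carrier S"
  unfolding E\<^sub>B_def
proof (rule T.restrict_end)
  show "abelian_group_hom T T (\<lambda>t. \<epsilon> (\<beta> (\<one>\<^bsub>A\<^esub> \<otimes>\<^sub>T t)))"
    by (rule abelian_group_hom_compose[OF abelian_group_hom_compose[OF pure_AT_hom_right XL.end_hom] \<epsilon>_hom])
      (simp_all add: \<beta>)
  fix r t assume "r \<in> carrier R" "t \<in> carrier T"
  \<comment> \<open>Since 1 \<otimes> r t = \<iota>(r) (1 \<otimes> t), the scalar passes first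
    through the A-linear \<open>\<beta>\<close> and then through \<open>\<epsilon>\<close>.\<close>
  then show "\<epsilon> (\<beta> (\<one>\<^bsub>A\<^esub> \<otimes>\<^sub>T (r \<odot>\<^bsub>T\<^esub> t))) = r \<odot>\<^bsub>T\<^esub> \<epsilon> (\<beta> (\<one>\<^bsub>A\<^esub> \<otimes>\<^sub>T t))"
    using pure_AT_balanced[of "\<one>\<^bsub>A\<^esub>" r t, symmetric] \<beta>
    by (simp add: pure_eq_smult[of "\<iota> r"] XL.end_smult XL.end_closed pure_AT_closed \<epsilon>_smult)
qed

text \<open>Products in B are applied from left to right. At 1 \<otimes> t, the left identity
  reaches 1 \<otimes> \<epsilon>(u d_i) with u = \<beta>(1 \<otimes> t) and then multiplies by c_i,
  which gives \<open>left_expansion\<close> of u; the right identity first produces d_i \<otimes> t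
  and gives \<open>right_expansion\<close> of u.\<close>

theorem frobenius_system_endomorphism_rings:
  "frobenius_system S B \<rho> E\<^sub>B I (\<lambda>i. rmult (c i)) (\<lambda>i. rmult (d i))"
proof (intro frobenius_system.intro frobenius_system_axioms.intro \<rho>_ring_hom finite_I rmult_c rmult_d E\<^sub>B_closed)
  fix \<beta> assume \<beta>: "\<beta> \<in> carrier B"
  have E\<^sub>B_\<beta>: "E\<^sub>B (rmult b \<otimes>\<^bsub>B\<^esub> \<beta>) \<in> carrier S" "E\<^sub>B (\<beta> \<otimes>\<^bsub>B\<^esub> rmult b) \<in> carrier S"
    if "rmult b \<in> carrier B" for b
    using that \<beta> by (auto intro: E\<^sub>B_closed)
  {
    fix \<gamma> assume \<gamma>: "\<gamma> \<in> carrier B"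
    show "E\<^sub>B (\<beta> \<oplus>\<^bsub>B\<^esub> \<gamma>) = E\<^sub>B \<beta> \<oplus>\<^bsub>S\<^esub> E\<^sub>B \<gamma>"
      using \<beta> \<gamma> by (intro T.end_eqI)
        (simp_all add: E\<^sub>B_closed E\<^sub>B_apply T.end_ring_apply XL.end_ring_apply XL.end_closed pure_AT_closed
          abelian_group_hom.hom_add[OF \<epsilon>_hom])
  }
  {
    fix s assume s: "s \<in> carrier S"
    show "E\<^sub>B (\<rho> s \<otimes>\<^bsub>B\<^esub> \<beta>) = s \<otimes>\<^bsub>S\<^esub> E\<^sub>B \<beta>"
      using \<beta> s by (intro T.end_eqI)
        (simp_all add: E\<^sub>B_closed \<rho>_closed E\<^sub>B_apply T.end_ring_apply XL.end_ring_apply T.end_closed pure_AT_closed \<rho>_pure)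
    show "E\<^sub>B (\<beta> \<otimes>\<^bsub>B\<^esub> \<rho> s) = E\<^sub>B \<beta> \<otimes>\<^bsub>S\<^esub> s"
      using \<beta> s by (intro T.end_eqI)
        (simp_all add: E\<^sub>B_closed \<rho>_closed E\<^sub>B_apply T.end_ring_apply XL.end_ring_apply XL.end_closed pure_AT_closed \<epsilon>_\<rho>)
  }
  show "(\<Oplus>\<^bsub>B\<^esub>i\<in>I. \<rho> (E\<^sub>B (\<beta> \<otimes>\<^bsub>B\<^esub> rmult (d i))) \<otimes>\<^bsub>B\<^esub> rmult (c i)) = \<beta>"
  proof (rule B_eqI[OF _ \<beta>])
    have summand: "(\<lambda>i. \<rho> (E\<^sub>B (\<beta> \<otimes>\<^bsub>B\<^esub> rmult (d i))) \<otimes>\<^bsub>B\<^esub> rmult (c i)) \<in> I \<rightarrow> carrier B"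
      by (simp add: \<rho>_closed E\<^sub>B_\<beta> rmult_c rmult_d)
    then show "(\<Oplus>\<^bsub>B\<^esub>i\<in>I. \<rho> (E\<^sub>B (\<beta> \<otimes>\<^bsub>B\<^esub> rmult (d i))) \<otimes>\<^bsub>B\<^esub> rmult (c i)) \<in> carrier B"
      by (rule XL.E.finsum_closed)
    fix t assume t: "t \<in> carrier T"
    let ?u = "\<beta> (\<one>\<^bsub>A\<^esub> \<otimes>\<^sub>T t)"
    have u: "?u \<in> carrier X" using \<beta> t by (simp add: XL.end_closed pure_AT_closed)
    have "(\<Oplus>\<^bsub>B\<^esub>i\<in>I. \<rho> (E\<^sub>B (\<beta> \<otimes>\<^bsub>B\<^esub> rmult (d i))) \<otimes>\<^bsub>B\<^esub> rmult (c i)) (\<one>\<^bsub>A\<^esub> \<otimes>\<^sub>T t) =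
        (\<Oplus>\<^bsub>X\<^esub>i\<in>I. (\<rho> (E\<^sub>B (\<beta> \<otimes>\<^bsub>B\<^esub> rmult (d i))) \<otimes>\<^bsub>B\<^esub> rmult (c i)) (\<one>\<^bsub>A\<^esub> \<otimes>\<^sub>T t))"
      using summand t by (intro XL.end_finsum) (simp_all add: pure_AT_closed)
    also have "\<dots> = (\<Oplus>\<^bsub>X\<^esub>i\<in>I. c i \<otimes>\<^sub>T \<epsilon> (rmult (d i) ?u))"
      using t u by (intro X.P.finsum_cong')
        (auto simp: XL.end_ring_apply pure_AT_closed \<rho>_pure E\<^sub>B_\<beta> E\<^sub>B_apply rmult_c rmult_d c_closed
          \<epsilon>_closed XL.end_closed[OF rmult_d(3)])
    also have "\<dots> = ?u"
      using u by (rule left_expansion)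
    finally show "(\<Oplus>\<^bsub>B\<^esub>i\<in>I. \<rho> (E\<^sub>B (\<beta> \<otimes>\<^bsub>B\<^esub> rmult (d i))) \<otimes>\<^bsub>B\<^esub> rmult (c i)) (\<one>\<^bsub>A\<^esub> \<otimes>\<^sub>T t) = ?u" .
  qed
  show "(\<Oplus>\<^bsub>B\<^esub>i\<in>I. rmult (d i) \<otimes>\<^bsub>B\<^esub> \<rho> (E\<^sub>B (rmult (c i) \<otimes>\<^bsub>B\<^esub> \<beta>))) = \<beta>"
  proof (rule B_eqI[OF _ \<beta>])
    have summand: "(\<lambda>i. rmult (d i) \<otimes>\<^bsub>B\<^esub> \<rho> (E\<^sub>B (rmult (c i) \<otimes>\<^bsub>B\<^esub> \<beta>))) \<in> I \<rightarrow> carrier B"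
      by (simp add: \<rho>_closed E\<^sub>B_\<beta> rmult_c rmult_d)
    then show "(\<Oplus>\<^bsub>B\<^esub>i\<in>I. rmult (d i) \<otimes>\<^bsub>B\<^esub> \<rho> (E\<^sub>B (rmult (c i) \<otimes>\<^bsub>B\<^esub> \<beta>))) \<in> carrier B"
      by (rule XL.E.finsum_closed)
    fix t assume t: "t \<in> carrier T"
    let ?u = "\<beta> (\<one>\<^bsub>A\<^esub> \<otimes>\<^sub>T t)"
    have u: "?u \<in> carrier X" using \<beta> t by (simp add: XL.end_closed pure_AT_closed)
    \<comment> \<open>Right multiplication by c_i takes 1 \<otimes> t to c_i \<otimes> t = c_i (1
      \<otimes> t); the left scalar c_i then commutes with \<open>\<beta>\<close>.\<close>
    have c_u: "\<beta> (c i \<otimes>\<^sub>T t) = c i \<odot>\<^bsub>X\<^esub> ?u" if "i \<in> I" for i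
      using that \<beta> t by (simp add: pure_eq_smult[of "c i"] c_closed XL.end_smult pure_AT_closed)
    have "(\<Oplus>\<^bsub>B\<^esub>i\<in>I. rmult (d i) \<otimes>\<^bsub>B\<^esub> \<rho> (E\<^sub>B (rmult (c i) \<otimes>\<^bsub>B\<^esub> \<beta>))) (\<one>\<^bsub>A\<^esub> \<otimes>\<^sub>T t) =
        (\<Oplus>\<^bsub>X\<^esub>i\<in>I. (rmult (d i) \<otimes>\<^bsub>B\<^esub> \<rho> (E\<^sub>B (rmult (c i) \<otimes>\<^bsub>B\<^esub> \<beta>))) (\<one>\<^bsub>A\<^esub> \<otimes>\<^sub>T t))"
      using summand t by (intro XL.end_finsum) (simp_all add: pure_AT_closed)
    also have "\<dots> = (\<Oplus>\<^bsub>X\<^esub>i\<in>I. d i \<otimes>\<^sub>T \<epsilon> (c i \<odot>\<^bsub>X\<^esub> ?u))"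
      using t u by (intro X.P.finsum_cong')
        (auto simp: XL.end_ring_apply pure_AT_closed \<rho>_pure E\<^sub>B_\<beta> E\<^sub>B_apply rmult_c rmult_d c_closed d_closed
          \<epsilon>_closed c_u XL.smult_closed)
    also have "\<dots> = ?u"
      using u by (rule right_expansion)
    finally show "(\<Oplus>\<^bsub>B\<^esub>i\<in>I. rmult (d i) \<otimes>\<^bsub>B\<^esub> \<rho> (E\<^sub>B (rmult (c i) \<otimes>\<^bsub>B\<^esub> \<beta>))) (\<one>\<^bsub>A\<^esub> \<otimes>\<^sub>T t) = ?u" .
  qed
qed

section \<open>The tensor product with the endomorphism ring\<close>

abbreviation "Y \<equiv> tensor S (end_bimodule T) (ring_bimodule B \<rho> id)"

sublocale \<rho>: ring_hom_ring S B \<rho>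
  by (rule \<rho>_ring_hom)

sublocale Y: tensor_factors S "end_bimodule T" "ring_bimodule B \<rho> id"
  by (intro tensor_factors.intro tensor_factors_axioms.intro X.N.abelian_group_axioms
      XL.E.abelian_group_ring_bimodule)
    (simp_all add: ring_bimodule_simps end_bimodule_simps T.end_closed)

abbreviation pure_TB (infixl \<open>\<otimes>\<^sub>B\<close> 75)
  where "t \<otimes>\<^sub>B \<beta> \<equiv> pure_tensor S (end_bimodule T) (ring_bimodule B \<rho> id) t \<beta>"

lemma pure_TB_closed: "\<lbrakk>t \<in> carrier T; \<beta> \<in> carrier B\<rbrakk> \<Longrightarrow> t \<otimes>\<^sub>B \<beta> \<in> carrier Y"
  using Y.pure_closed by (simp add: ring_bimodule_simps end_bimodule_simps)

lemma pure_TB_balanced: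
  "\<lbrakk>t \<in> carrier T; s \<in> carrier S; \<beta> \<in> carrier B\<rbrakk> \<Longrightarrow> s t \<otimes>\<^sub>B \<beta> = t \<otimes>\<^sub>B (\<rho> s \<otimes>\<^bsub>B\<^esub> \<beta>)"
  using Y.pure_balanced by (simp add: ring_bimodule_simps end_bimodule_simps)

lemma pure_TB_hom_left: "\<beta> \<in> carrier B \<Longrightarrow> abelian_group_hom T Y (\<lambda>t. t \<otimes>\<^sub>B \<beta>)"
  by (rule abelian_group_hom_of_additive)
    (use Y.pure_add_left in \<open>simp_all add: T.M.abelian_group_axioms Y.P.abelian_group_axioms pure_TB_closed
      ring_bimodule_simps end_bimodule_simps\<close>)

lemma pure_TB_hom_right: "t \<in> carrier T \<Longrightarrow> abelian_group_hom B Y (\<lambda>\<beta>. t \<otimes>\<^sub>B \<beta>)"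
  by (rule abelian_group_hom_of_additive)
    (use Y.pure_add_right in \<open>simp_all add: XL.E.abelian_group_axioms Y.P.abelian_group_axioms pure_TB_closed
      ring_bimodule_simps end_bimodule_simps\<close>)

lemma Y_hom_eqI:
  assumes "abelian_group_hom Y G h" "abelian_group_hom Y G k" "u \<in> carrier Y"
    and "\<And>t \<beta>. \<lbrakk>t \<in> carrier T; \<beta> \<in> carrier B\<rbrakk> \<Longrightarrow> h (t \<otimes>\<^sub>B \<beta>) = k (t \<otimes>\<^sub>B \<beta>)"
  shows "h u = k u"
  using assms by (intro Y.tensor_hom_eqI[of G h k u]) (auto simp: ring_bimodule_simps end_bimodule_simps)

section \<open>The R-B-bimodule structure of T \<otimes> B\<close>

lemma Y_smult_hom: "r \<in> carrier R \<Longrightarrow> abelian_group_hom Y Y (\<lambda>u. r \<odot>\<^bsub>Y\<^esub> u)"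
  by (rule Y.tensor_smult_hom[OF T.left_module_end_bimodule]) (simp_all add: end_bimodule_simps T.end_smult)

lemma Y_smult_pure:
  "\<lbrakk>r \<in> carrier R; t \<in> carrier T; \<beta> \<in> carrier B\<rbrakk> \<Longrightarrow> r \<odot>\<^bsub>Y\<^esub> (t \<otimes>\<^sub>B \<beta>) = (r \<odot>\<^bsub>T\<^esub> t) \<otimes>\<^sub>B \<beta>"
  using Y.tensor_smult_pure[OF T.left_module_end_bimodule, of r t \<beta>]
  by (simp add: ring_bimodule_simps end_bimodule_simps T.end_smult)

context
  fixes b
  assumes b: "b \<in> carrier B"
begin

lemma B_mult_hom:
  "abelian_group_hom (ring_bimodule B \<rho> id) (ring_bimodule B \<rho> id) (\<lambda>\<beta>. \<beta> \<cdot>\<^bsub>ring_bimodule B \<rho> id\<^esub> b)"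
  using b by (intro abelian_group_hom_of_additive XL.E.abelian_group_ring_bimodule)
    (simp_all add: ring_bimodule_simps XL.E.l_distr)

lemma Y_rsmult_hom: "abelian_group_hom Y Y (\<lambda>u. u \<cdot>\<^bsub>Y\<^esub> b)"
  using b by (intro Y.tensor_rsmult_hom[OF B_mult_hom]) (simp add: ring_bimodule_simps XL.E.m_assoc)

lemma Y_rsmult_pure:
  "\<lbrakk>t \<in> carrier T; \<beta> \<in> carrier B\<rbrakk> \<Longrightarrow> (t \<otimes>\<^sub>B \<beta>) \<cdot>\<^bsub>Y\<^esub> b = t \<otimes>\<^sub>B (\<beta> \<otimes>\<^bsub>B\<^esub> b)"
  using b Y.tensor_rsmult_pure[OF B_mult_hom, of t \<beta>]
  by (simp add: ring_bimodule_simps end_bimodule_simps XL.E.m_assoc)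

end

text \<open>Balancing over S amounts to \<beta>(1 \<otimes> s(t)) = \<beta>(\<rho>(s)(1 \<otimes>
  t)), and the right side is the product of \<rho>(s) and \<beta> in B evaluated at 1 \<otimes>
  t.\<close>

lemma evaluation_hom:
  obtains h where "abelian_group_hom Y X h"
    "\<And>t \<beta>. \<lbrakk>t \<in> carrier T; \<beta> \<in> carrier B\<rbrakk> \<Longrightarrow> h (t \<otimes>\<^sub>B \<beta>) = \<beta> (\<one>\<^bsub>A\<^esub> \<otimes>\<^sub>T t)"
proof (rule Y.tensor_universal[OF X.P.abelian_group_axioms, of "\<lambda>t \<beta>. \<beta> (\<one>\<^bsub>A\<^esub> \<otimes>\<^sub>T t)"])
  fix h
  assume "abelian_group_hom Y X h"
    "\<And>t \<beta>. \<lbrakk>t \<in> carrier (end_bimodule T); \<beta> \<in> carrier (ring_bimodule B \<rho> id)\<rbrakk> \<Longrightarrow>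
      h (t \<otimes>\<^sub>B \<beta>) = \<beta> (\<one>\<^bsub>A\<^esub> \<otimes>\<^sub>T t)"
  then show thesis
    by (intro that) (simp_all add: ring_bimodule_simps end_bimodule_simps)
qed (simp_all add: ring_bimodule_simps end_bimodule_simps XL.end_closed pure_AT_closed XL.end_add
    abelian_group_hom.hom_add[OF pure_AT_hom_right] XL.end_ring_apply \<rho>_pure)

theorem tensor_endomorphism_ring_iso:
  "bimodule_iso R B Y (restrict_left_scalars \<iota> (end_bimodule X))"
proof -
  obtain h where h: "abelian_group_hom Y X h"
    and h_pure: "\<And>t \<beta>. \<lbrakk>t \<in> carrier T; \<beta> \<in> carrier B\<rbrakk> \<Longrightarrow> h (t \<otimes>\<^sub>B \<beta>) = \<beta> (\<one>\<^bsub>A\<^esub> \<otimes>\<^sub>T t)"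
    by (rule evaluation_hom) blast
  interpret h: abelian_group_hom Y X h by (rule h)
  define k where "k u = (\<Oplus>\<^bsub>Y\<^esub>i\<in>I. \<epsilon> (rmult (d i) u) \<otimes>\<^sub>B rmult (c i))" for u
  have k: "abelian_group_hom X Y k"
    unfolding k_def
    by (intro abelian_group_hom_finsum X.P.abelian_group_axioms Y.P.abelian_group_axioms
        abelian_group_hom_compose[OF abelian_group_hom_compose[OF rmult_d(2) \<epsilon>_hom] pure_TB_hom_left] rmult_c(3))
  have rmult_d_closed: "rmult (d i) u \<in> carrier X" if "i \<in> I" "u \<in> carrier X" for i u
    using XL.end_closed[OF rmult_d(3)] that by blast
  \<comment> \<open>\<open>h\<close> evaluates the i-th summand of k(u) to c_i \<otimes>
    \<epsilon>(u d_i), so the composite is \<open>left_expansion\<close>.\<close>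
  have hk: "h (k u) = u" if u: "u \<in> carrier X" for u
  proof -
    have "h (k u) = (\<Oplus>\<^bsub>X\<^esub>i\<in>I. h (\<epsilon> (rmult (d i) u) \<otimes>\<^sub>B rmult (c i)))"
      unfolding k_def using u
      by (intro h.hom_finsum) (auto intro!: pure_TB_closed \<epsilon>_closed rmult_d_closed rmult_c)
    also have "\<dots> = (\<Oplus>\<^bsub>X\<^esub>i\<in>I. c i \<otimes>\<^sub>T \<epsilon> (rmult (d i) u))"
      using u by (intro X.P.finsum_cong')
        (auto simp: h_pure rmult_c \<epsilon>_closed rmult_d_closed c_closed pure_AT_closed)
    finally show ?thesis
      using left_expansion[OF u] by simp
  qed
  have kh: "k (h y) = y" if y: "y \<in> carrier Y" for y
    using abelian_group_hom_compose[OF h k] abelian_group_hom_ident[OF Y.P.abelian_group_axioms] y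
  proof (rule Y_hom_eqI)
    fix t \<beta> assume t: "t \<in> carrier T" and \<beta>: "\<beta> \<in> carrier B"
    interpret F: frobenius_system S B \<rho> E\<^sub>B I "\<lambda>i. rmult (c i)" "\<lambda>i. rmult (d i)"
      by (rule frobenius_system_endomorphism_rings)
    have E\<^sub>B_\<beta>: "E\<^sub>B (\<beta> \<otimes>\<^bsub>B\<^esub> rmult (d i)) \<in> carrier S" if "i \<in> I" for i
      using that \<beta> by (simp add: E\<^sub>B_closed rmult_d)
    have summand: "\<epsilon> (rmult (d i) (\<beta> (\<one>\<^bsub>A\<^esub> \<otimes>\<^sub>T t))) \<otimes>\<^sub>B rmult (c i) =
        t \<otimes>\<^sub>B (\<rho> (E\<^sub>B (\<beta> \<otimes>\<^bsub>B\<^esub> rmult (d i))) \<otimes>\<^bsub>B\<^esub> rmult (c i))" if i: "i \<in> I" for i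
    proof -
      have "\<epsilon> (rmult (d i) (\<beta> (\<one>\<^bsub>A\<^esub> \<otimes>\<^sub>T t))) = E\<^sub>B (\<beta> \<otimes>\<^bsub>B\<^esub> rmult (d i)) t"
        using t by (simp add: E\<^sub>B_apply XL.end_ring_apply pure_AT_closed)
      then show ?thesis
        using t i by (simp add: pure_TB_balanced E\<^sub>B_\<beta> rmult_c)
    qed
    have "k (h (t \<otimes>\<^sub>B \<beta>)) =
        (\<Oplus>\<^bsub>Y\<^esub>i\<in>I. t \<otimes>\<^sub>B (\<rho> (E\<^sub>B (\<beta> \<otimes>\<^bsub>B\<^esub> rmult (d i))) \<otimes>\<^bsub>B\<^esub> rmult (c i)))"
      unfolding h_pure[OF t \<beta>] k_def using t \<beta>
      by (intro Y.P.finsum_cong') (auto simp: summand pure_TB_closed E\<^sub>B_\<beta> \<rho>_closed rmult_c)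
    also have "\<dots> = t \<otimes>\<^sub>B (\<Oplus>\<^bsub>B\<^esub>i\<in>I. \<rho> (E\<^sub>B (\<beta> \<otimes>\<^bsub>B\<^esub> rmult (d i))) \<otimes>\<^bsub>B\<^esub> rmult (c i))"
      by (intro abelian_group_hom.hom_finsum[OF pure_TB_hom_right[OF t], symmetric])
        (auto simp: E\<^sub>B_\<beta> \<rho>_closed rmult_c)
    finally show "k (h (t \<otimes>\<^sub>B \<beta>)) = t \<otimes>\<^sub>B \<beta>"
      by (simp only: F.left_basis[OF \<beta>])
  qed
  have "h (r \<odot>\<^bsub>Y\<^esub> y) = \<iota> r \<odot>\<^bsub>X\<^esub> h y" if r: "r \<in> carrier R" and y: "y \<in> carrier Y" for r y
    using abelian_group_hom_compose[OF Y_smult_hom[OF r] h]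
      abelian_group_hom_compose[OF h XL.smult_hom[OF hom_closed[OF r]]] y
  proof (rule Y_hom_eqI)
    fix t \<beta> assume "t \<in> carrier T" "\<beta> \<in> carrier B"
    \<comment> \<open>Again r t enters as 1 \<otimes> r t = \<iota>(r) (1 \<otimes> t), and
      \<open>\<beta>\<close> is A-linear.\<close>
    then show "h (r \<odot>\<^bsub>Y\<^esub> (t \<otimes>\<^sub>B \<beta>)) = \<iota> r \<odot>\<^bsub>X\<^esub> h (t \<otimes>\<^sub>B \<beta>)"
      using r pure_AT_balanced[of "\<one>\<^bsub>A\<^esub>" r t, symmetric]
      by (simp add: Y_smult_pure h_pure T.smult_closed pure_eq_smult[of "\<iota> r"] XL.end_smult pure_AT_closed)
  qed
  moreover have "h (y \<cdot>\<^bsub>Y\<^esub> b) = b (h y)" if b: "b \<in> carrier B" and y: "y \<in> carrier Y" for b y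
    using abelian_group_hom_compose[OF Y_rsmult_hom[OF b] h]
      abelian_group_hom_compose[OF h XL.end_hom[OF b]] y
    by (rule Y_hom_eqI) (simp_all add: b Y_rsmult_pure h_pure XL.end_ring_apply pure_AT_closed)
  moreover have "y \<cdot>\<^bsub>Y\<^esub> b \<in> carrier Y" if "b \<in> carrier B" "y \<in> carrier Y" for b y
    using abelian_group_hom.hom_closed[OF Y_rsmult_hom] that by blast
  moreover have "r \<odot>\<^bsub>Y\<^esub> y \<in> carrier Y" if "r \<in> carrier R" "y \<in> carrier Y" for r y
    using abelian_group_hom.hom_closed[OF Y_smult_hom] that by blast
  moreover have "bij_betw (restrict h (carrier Y)) (carrier Y) (carrier X)"
    unfolding bij_betw_restrict_eq using abelian_group_hom.hom_closed[OF k]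
    by (intro bij_betw_byWitness[where f' = k]) (auto simp: hk kh)
  ultimately show ?thesis
    unfolding bimodule_iso_def
    by (intro bexI[of _ "restrict h (carrier Y)"])
      (auto simp: left_hom_def restrict_left_scalars_simps end_bimodule_simps)
qed

end

theorem corollary3p4:
  fixes R :: "('r, 'x) ring_scheme" and A :: "('a, 'y) ring_scheme"
    and \<iota> :: "'r \<Rightarrow> 'a" and T :: "('r, 't, 'z) module_scheme"
  assumes frobenius: "frobenius_extension R A \<iota>"
    and centrally_projective: "centrally_projective R A \<iota>"
    and T: "left_module R T"
    and S: "S = end_ring R T"
    and B: "B = end_ring A (induced_module R A \<iota> T)"
    and \<rho>: "\<rho> = induced_end R A \<iota> T"
  shows "frobenius_extension S B \<rho> \<and>
    bimodule_iso R B (tensor S (end_bimodule T) (ring_bimodule B \<rho> id))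
      (restrict_left_scalars \<iota> (end_bimodule (induced_module R A \<iota> T)))"
proof -
  obtain n :: nat and E c d where "frobenius_system R A \<iota> E {..<n} c d"
    "\<And>i r. \<lbrakk>i < n; r \<in> carrier R\<rbrakk> \<Longrightarrow> c i \<otimes>\<^bsub>A\<^esub> \<iota> r = \<iota> r \<otimes>\<^bsub>A\<^esub> c i"
    "\<And>i r. \<lbrakk>i < n; r \<in> carrier R\<rbrakk> \<Longrightarrow> d i \<otimes>\<^bsub>A\<^esub> \<iota> r = \<iota> r \<otimes>\<^bsub>A\<^esub> d i"
    by (rule centrally_projective_frobenius_system[OF frobenius centrally_projective]) blast
  then interpret C: central_frobenius_system R A \<iota> E "{..<n}" c d T
    using T by (intro central_frobenius_system.intro central_frobenius_system_axioms.intro) auto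
  \<comment> \<open>The locale restates \<open>induced_end\<close> with R, A and T fixed; unfolding
    identifies the two maps.\<close>
  have "\<rho> = C.\<rho>"
    by (rule ext) (simp add: \<rho> induced_end_def induced_module_def C.\<rho>_def)
  then show ?thesis
    unfolding S B induced_module_def
    using frobenius_system.frobenius_extension[OF C.frobenius_system_endomorphism_rings]
      C.tensor_endomorphism_ring_iso
    by simp
qed

end
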